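(* Let $\Omega$ be a $\sigma$-compact metric space, $\nu$ a probability measure on the Borel $\sigma$-field of $\Omega$, $\mathcal{C}\in\mathbb{C}^{I_1\times\cdots\times I_N\times I_1\times\cdots\times I_N}$ a Hermitian tensor and $\tau\mapsto\mathcal{D}_\tau$ a continuous map from $\Omega$ into Hermitian tensors of the same size with $\sup\{\|\mathcal{D}_\tau\|:\tau\in\Omega\}<\infty$, all of Hermitian rank $r$. Then the following are equivalent: (i) $\vec\lambda(\mathcal{C})\prec_w\int_{\Omega^r}\vec\lambda(\mathcal{D}_\tau)\,d\nu^r(\tau)$; (ii) for every non-decreasing convex function $f:\mathbb{R}\to[0,\infty)$ and every unitarily invariant norm $\|\cdot\|_\rho$, $\|f(\mathcal{C})\|_\rho\le\int_\Omega\|f(\mathcal{D}_\tau)\|_\rho\,d\nu(\tau)$.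
   Context: Einstein product, conjugate transpose and Hermitian tensors: $(\mathcal{A}\star_N\mathcal{B})_{i,k}=\sum_j a_{i,j}b_{j,k}$ over multi-indices, $(\mathcal{A}^H)_{j,i}=\overline{a_{i,j}}$. A Hermitian tensor decomposes as $\mathcal{H}=\sum_{i=1}^r\lambda_i\mathcal{U}_i\otimes\mathcal{U}_i^H$ with real Hermitian eigenvalues $\lambda_i$ and orthonormal $\mathcal{U}_i$; $r$ (minimal) is the Hermitian rank; $\vec\lambda(\mathcal{H})=(\lambda_1(\mathcal{H}),\dots,\lambda_r(\mathcal{H}))$ lists them in decreasing order; $f(\mathcal{H})=\sum_i f(\lambda_i)\mathcal{U}_i\otimes\mathcal{U}_i^H$; $|\mathcal{A}|=(\mathcal{A}^H\star_N\mathcal{A})^{1/2}$; $\|\cdot\|$ is the operator norm. Notation: $\int_{\Omega^r}\vec\lambda(\mathcal{D}_\tau)d\nu^r(\tau)=\left(\int_\Omega\lambda_1(\mathcal{D}_\tau)d\nu(\tau),\dots,\int_\Omega\lambda_r(\mathcal{D}_\tau)d\nu(\tau)\right)$. For $\mathbf{x},\mathbf{y}\in\mathbb{R}^r$ with decreasingly ordered entries, $\mathbf{x}\prec_w\mathbf{y}$ means $\sum_{i=1}^kx_i\le\sum_{i=1}^ky_i$ for all $k=1,\dots,r$. A unitarily invariant norm satisfies $\|\mathcal{U}\mathcal{H}\|_\rho=\|\mathcal{H}\mathcal{U}\|_\rho=\|\mathcal{H}\|_\rho$ for unitary $\mathcal{U}$ and $\|\mathcal{H}\|_\rho=\rho(\vec\lambda(|\mathcal{H}|))$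 for a symmetric gauge function $\rho$. *)

theory Defs
  imports "HOL-Probability.Probability"
begin

text \<open>Tensors in C^(I1 x ... x IN x I1 x ... x IN) are represented as functions
  nat list => nat list => complex (row multi-index, column multi-index), required to vanish
  outside the multi-index set; tensors in C^(I1 x ... x IN) as nat list => complex.
  The size vector (I1,...,IN) is the list Is.\<close>

definition tidx :: "nat list \<Rightarrow> nat list set" where
  "tidx Is = {xs. length xs = length Is \<and> (\<forall>k<length Is. xs ! k < Is ! k)}"

definition tsize :: "nat list \<Rightarrow> nat" where
  "tsize Is = card (tidx Is)"

definition is_tensor :: "nat list \<Rightarrow> (nat list \<Rightarrow> nat list \<Rightarrow> complex) \<Rightarrow> bool" where
  "is_tensor Is A \<longleftrightarrow> (\<forall>i j. i \<notin> tidx Is \<or> j \<notin> tidx Is \<longrightarrow> A i j = 0)"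

definition is_vtensor :: "nat list \<Rightarrow> (nat list \<Rightarrow> complex) \<Rightarrow> bool" where
  "is_vtensor Is U \<longleftrightarrow> (\<forall>i. i \<notin> tidx Is \<longrightarrow> U i = 0)"

definition einstein :: "nat list \<Rightarrow> (nat list \<Rightarrow> nat list \<Rightarrow> complex)
    \<Rightarrow> (nat list \<Rightarrow> nat list \<Rightarrow> complex) \<Rightarrow> (nat list \<Rightarrow> nat list \<Rightarrow> complex)" where
  "einstein Is A B = (\<lambda>i k. \<Sum>j\<in>tidx Is. A i j * B j k)"

definition hconj :: "(nat list \<Rightarrow> nat list \<Rightarrow> complex) \<Rightarrow> (nat list \<Rightarrow> nat list \<Rightarrow> complex)" where
  "hconj A = (\<lambda>j i. cnj (A i j))"

definition hermitian :: "nat list \<Rightarrow> (nat list \<Rightarrow> nat list \<Rightarrow> complex) \<Rightarrow> bool" where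
  "hermitian Is A \<longleftrightarrow> is_tensor Is A \<and> hconj A = A"

definition outer :: "(nat list \<Rightarrow> complex) \<Rightarrow> (nat list \<Rightarrow> complex) \<Rightarrow> (nat list \<Rightarrow> nat list \<Rightarrow> complex)" where
  "outer U V = (\<lambda>i j. U i * cnj (V j))"

definition tinner :: "nat list \<Rightarrow> (nat list \<Rightarrow> complex) \<Rightarrow> (nat list \<Rightarrow> complex) \<Rightarrow> complex" where
  "tinner Is U V = (\<Sum>x\<in>tidx Is. U x * cnj (V x))"

definition orthonormal_fam :: "nat list \<Rightarrow> nat \<Rightarrow> (nat \<Rightarrow> nat list \<Rightarrow> complex) \<Rightarrow> bool" where
  "orthonormal_fam Is r Us \<longleftrightarrow> (\<forall>k<r. is_vtensor Is (Us k)) \<and>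
     (\<forall>k<r. \<forall>l<r. tinner Is (Us k) (Us l) = (if k = l then 1 else 0))"

definition herm_decomp :: "nat list \<Rightarrow> (nat list \<Rightarrow> nat list \<Rightarrow> complex) \<Rightarrow> nat
    \<Rightarrow> (nat \<Rightarrow> real) \<Rightarrow> (nat \<Rightarrow> nat list \<Rightarrow> complex) \<Rightarrow> bool" where
  "herm_decomp Is H r lam Us \<longleftrightarrow> orthonormal_fam Is r Us \<and>
     H = (\<lambda>i j. \<Sum>k<r. complex_of_real (lam k) * outer (Us k) (Us k) i j)"

definition herm_rank :: "nat list \<Rightarrow> (nat list \<Rightarrow> nat list \<Rightarrow> complex) \<Rightarrow> nat" where
  "herm_rank Is H = (LEAST r. \<exists>lam Us. herm_decomp Is H r lam Us)"

definition min_decomp :: "nat list \<Rightarrow> (nat list \<Rightarrow> nat list \<Rightarrow> complex)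
    \<Rightarrow> (nat \<Rightarrow> real) \<times> (nat \<Rightarrow> nat list \<Rightarrow> complex)" where
  "min_decomp Is H = (SOME p. herm_decomp Is H (herm_rank Is H) (fst p) (snd p))"

definition hevals :: "nat list \<Rightarrow> (nat list \<Rightarrow> nat list \<Rightarrow> complex) \<Rightarrow> real list" where
  "hevals Is H = rev (sort (map (fst (min_decomp Is H)) [0..<herm_rank Is H]))"

definition tfun :: "nat list \<Rightarrow> (real \<Rightarrow> real) \<Rightarrow> (nat list \<Rightarrow> nat list \<Rightarrow> complex)
    \<Rightarrow> (nat list \<Rightarrow> nat list \<Rightarrow> complex)" where
  "tfun Is f H = (\<lambda>i j. \<Sum>k<herm_rank Is H.
      complex_of_real (f (fst (min_decomp Is H) k)) * outer (snd (min_decomp Is H) k) (snd (min_decomp Is H) k) i j)"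

definition tabs :: "nat list \<Rightarrow> (nat list \<Rightarrow> nat list \<Rightarrow> complex) \<Rightarrow> (nat list \<Rightarrow> nat list \<Rightarrow> complex)" where
  "tabs Is A = tfun Is sqrt (einstein Is (hconj A) A)"

definition vnorm :: "nat list \<Rightarrow> (nat list \<Rightarrow> complex) \<Rightarrow> real" where
  "vnorm Is x = sqrt (\<Sum>i\<in>tidx Is. (cmod (x i))\<^sup>2)"

definition op_norm :: "nat list \<Rightarrow> (nat list \<Rightarrow> nat list \<Rightarrow> complex) \<Rightarrow> real" where
  "op_norm Is A = Sup {vnorm Is (\<lambda>i. \<Sum>j\<in>tidx Is. A i j * x j) | x. is_vtensor Is x \<and> vnorm Is x = 1}"

definition sym_gauge :: "nat \<Rightarrow> (real list \<Rightarrow> real) \<Rightarrow> bool" where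
  "sym_gauge n \<rho> \<longleftrightarrow>
     (\<forall>x. length x = n \<longrightarrow> \<rho> x \<ge> 0 \<and> (\<rho> x = 0 \<longleftrightarrow> (\<forall>a\<in>set x. a = 0))) \<and>
     (\<forall>c x. length x = n \<longrightarrow> \<rho> (map (\<lambda>a. c * a) x) = \<bar>c\<bar> * \<rho> x) \<and>
     (\<forall>x y. length x = n \<and> length y = n \<longrightarrow> \<rho> (map2 (+) x y) \<le> \<rho> x + \<rho> y) \<and>
     (\<forall>x y. length x = n \<and> mset x = mset y \<longrightarrow> \<rho> x = \<rho> y) \<and>
     (\<forall>x. length x = n \<longrightarrow> \<rho> (map abs x) = \<rho> x)"

definition pad :: "real list \<Rightarrow> nat \<Rightarrow> real list" where
  "pad xs n = xs @ replicate (n - length xs) 0"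

definition ui_norm :: "nat list \<Rightarrow> (real list \<Rightarrow> real) \<Rightarrow> (nat list \<Rightarrow> nat list \<Rightarrow> complex) \<Rightarrow> real" where
  "ui_norm Is \<rho> A = \<rho> (pad (hevals Is (tabs Is A)) (tsize Is))"

definition weak_maj :: "real list \<Rightarrow> real list \<Rightarrow> bool" where
  "weak_maj x y \<longleftrightarrow> length x = length y \<and>
     (\<forall>k\<in>{1..length x}. (\<Sum>i<k. x ! i) \<le> (\<Sum>i<k. y ! i))"

definition sigma_compact_space :: "'a::metric_space itself \<Rightarrow> bool" where
  "sigma_compact_space _ \<longleftrightarrow> (\<exists>K::nat \<Rightarrow> 'a set. (\<forall>n. compact (K n)) \<and> (\<Union>n. K n) = UNIV)"

end

theory Submission
  imports Defs
begin

text \<open>The eigenvalues of \<open>f(H)\<close> are the \<open>f(\<lambda>\<^sub>i(H))\<close>, so everything happens on eigenvalue vectors. For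
  (i) \<open>\<Longrightarrow>\<close> (ii), a non-decreasing convex \<open>f\<close> preserves weak majorisation, Jensen's inequality moves
  \<open>f\<close> inside the integral, a symmetric gauge function is monotone for weak majorisation, and the gauge
  function moves inside the integral because it has a supporting functional at every point. For the
  converse take the Ky Fan norms and \<open>f(x) = max 0 (x + c)\<close>, which is a shift on the spectra
  once \<open>c\<close> is large. Measurability of \<open>\<tau> \<mapsto> \<lambda>\<^sub>i(D\<^sub>\<tau>)\<close> comes from the traces of powers of \<open>D\<^sub>\<tau>\<close>:
  by Weierstrass approximation they determine the number of eigenvalues above any
  level.\<close>

text \<open>On the tensor side the obstacle is that \<open>hevals\<close> rests on a least rank and
  a chosen decomposition and lists nonzero eigenvalues only, while \<open>f\<close> may send a
  nonzero eigenvalue to 0 and so lower the rank. Spectra are therefore compared as multisets up to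
  zeros, and padding to \<open>tsize Is\<close> restores the zeros that were lost. On the kernel
  \<open>tfun\<close> puts 0, not \<open>f 0\<close>; as \<open>C\<close> and every
  \<open>D \<tau>\<close> have rank \<open>r\<close>, the padding starts at the same position for
  all of them. Measurability cannot be skipped: the integral of a non-integrable function is 0 by
  convention, and either side of the equivalence would then speak about that default value.\<close>

lemma finite_tidx [simp]: "finite (tidx Is)"
proof (rule finite_subset)
  show "tidx Is \<subseteq> {xs. set xs \<subseteq> {..sum_list Is} \<and> length xs = length Is}"
  proof
    fix xs assume xs: "xs \<in> tidx Is"
    have "x \<le> sum_list Is" if "x \<in> set xs" for x :: nat
    proof -
      obtain k where k: "k < length xs" "x = xs ! k" using \<open>x \<in> set xs\<close> by (metis in_set_conv_nth)
      then have "x < Is ! k" "Is ! k \<le> sum_list Is"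
        using xs by (auto simp: tidx_def intro: member_le_sum_list)
      then show ?thesis by simp
    qed
    then show "xs \<in> {xs. set xs \<subseteq> {..sum_list Is} \<and> length xs = length Is}"
      using xs by (auto simp: tidx_def)
  qed
qed (rule finite_lists_length_eq, simp)

section \<open>Vector tensors as an inner product space on which tensors act\<close>

definition tapp :: "nat list \<Rightarrow> (nat list \<Rightarrow> nat list \<Rightarrow> complex) \<Rightarrow> (nat list \<Rightarrow> complex)
    \<Rightarrow> (nat list \<Rightarrow> complex)" where
  "tapp Is A x = (\<lambda>i. \<Sum>j\<in>tidx Is. A i j * x j)"

lemma tinner_cnj: "cnj (tinner Is x y) = tinner Is y x"
  by (simp add: tinner_def mult.commute)

lemma tinner_add_left: "tinner Is (\<lambda>i. x i + y i) z = tinner Is x z + tinner Is y z"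
  by (simp add: tinner_def distrib_right sum.distrib)

lemma tinner_diff_left: "tinner Is (\<lambda>i. x i - y i) z = tinner Is x z - tinner Is y z"
  by (simp add: tinner_def left_diff_distrib sum_subtractf)

lemma tinner_scale_left: "tinner Is (\<lambda>i. c * x i) z = c * tinner Is x z"
  by (simp add: tinner_def sum_distrib_left mult.assoc)

lemma tinner_scale_right: "tinner Is z (\<lambda>i. c * x i) = cnj c * tinner Is z x"
  by (simp add: tinner_def sum_distrib_left mult_ac)

lemma tinner_sum_left:
  "tinner Is (\<lambda>i. \<Sum>k\<in>K. c k * u k i) z = (\<Sum>k\<in>K. c k * tinner Is (u k) z)"
  unfolding tinner_def sum_distrib_right sum_distrib_left
  by (subst sum.swap) (simp add: mult.assoc)

lemma tinner_self: "tinner Is x x = complex_of_real (\<Sum>i\<in>tidx Is. (cmod (x i))\<^sup>2)"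
  by (simp add: tinner_def complex_norm_square del: of_real_power)

lemma vnorm_power2: "(vnorm Is x)\<^sup>2 = (\<Sum>i\<in>tidx Is. (cmod (x i))\<^sup>2)"
  by (simp add: vnorm_def sum_nonneg)

lemma tinner_self_vnorm: "tinner Is x x = complex_of_real ((vnorm Is x)\<^sup>2)"
  by (simp only: tinner_self vnorm_power2)

lemma vnorm_nonneg [simp]: "0 \<le> vnorm Is x"
  by (simp add: vnorm_def sum_nonneg)

lemma vnorm_scale: "vnorm Is (\<lambda>i. c * x i) = cmod c * vnorm Is x"
  by (simp add: vnorm_def norm_mult power_mult_distrib real_sqrt_mult flip: sum_distrib_left)

lemma vnorm_eq_0: "is_vtensor Is x \<Longrightarrow> vnorm Is x = 0 \<longleftrightarrow> x = (\<lambda>i. 0)"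
  by (auto simp: vnorm_def sum_nonneg_eq_0_iff is_vtensor_def fun_eq_iff)

lemma orthonormal_fam_vnorm: "orthonormal_fam Is m U \<Longrightarrow> k < m \<Longrightarrow> vnorm Is (U k) = 1"
  using tinner_self_vnorm[of Is "U k"] vnorm_nonneg[of Is "U k"]
  by (auto simp: orthonormal_fam_def power2_eq_1_iff simp flip: of_real_power simp del: vnorm_nonneg)

lemma tapp_add: "tapp Is A (\<lambda>i. x i + y i) = (\<lambda>i. tapp Is A x i + tapp Is A y i)"
  by (simp add: tapp_def distrib_left sum.distrib)

lemma tapp_diff: "tapp Is A (\<lambda>i. x i - y i) = (\<lambda>i. tapp Is A x i - tapp Is A y i)"
  by (simp add: tapp_def right_diff_distrib sum_subtractf)

lemma tapp_scale: "tapp Is A (\<lambda>i. c * x i) = (\<lambda>i. c * tapp Is A x i)"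
  by (simp add: tapp_def sum_distrib_left mult_ac)

lemma is_vtensor_tapp: "is_tensor Is A \<Longrightarrow> is_vtensor Is (tapp Is A x)"
  by (auto simp: is_vtensor_def tapp_def is_tensor_def)

lemma hermitian_cnj: "hermitian Is A \<Longrightarrow> cnj (A i j) = A j i"
  unfolding hermitian_def hconj_def by metis

lemma tinner_tapp: "hermitian Is A \<Longrightarrow> tinner Is (tapp Is A x) y = tinner Is x (tapp Is A y)"
  unfolding tinner_def tapp_def sum_distrib_right sum_distrib_left cnj_sum
  by (subst sum.swap) (simp add: hermitian_cnj mult_ac)

section \<open>Orthonormal decompositions of Hermitian tensors\<close>

lemma herm_decomp_tapp:
  assumes "herm_decomp Is H m lam U"
  shows "tapp Is H x = (\<lambda>i. \<Sum>k<m. complex_of_real (lam k) * tinner Is x (U k) * U k i)"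
proof
  fix i
  have "tapp Is H x i = (\<Sum>j\<in>tidx Is. \<Sum>k<m. lam k * (U k i * cnj (U k j)) * x j)"
    using assms by (simp add: tapp_def herm_decomp_def outer_def sum_distrib_right)
  also have "\<dots> = (\<Sum>k<m. \<Sum>j\<in>tidx Is. lam k * (U k i * cnj (U k j)) * x j)"
    by (rule sum.swap)
  also have "\<dots> = (\<Sum>k<m. complex_of_real (lam k) * tinner Is x (U k) * U k i)"
    by (simp add: tinner_def sum_distrib_left sum_distrib_right mult_ac)
  finally show "tapp Is H x i = (\<Sum>k<m. complex_of_real (lam k) * tinner Is x (U k) * U k i)" .
qed

lemma orthonormal_famD:
  assumes "orthonormal_fam Is m U" "k < m"
  shows "is_vtensor Is (U k)" "l < m \<Longrightarrow> tinner Is (U k) (U l) = (if k = l then 1 else 0)"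
  using assms by (auto simp: orthonormal_fam_def)

lemma herm_decomp_eigen:
  assumes "herm_decomp Is H m lam U" "k < m"
  shows "tapp Is H (U k) = (\<lambda>i. complex_of_real (lam k) * U k i)"
proof -
  have on: "orthonormal_fam Is m U" using assms by (simp add: herm_decomp_def)
  have "(\<Sum>l<m. complex_of_real (lam l) * tinner Is (U k) (U l) * U l i)
      = (\<Sum>l<m. if k = l then lam l * U l i else 0)" for i
    using on assms(2) by (intro sum.cong) (auto simp: orthonormal_famD)
  then show ?thesis using assms(2) by (simp add: herm_decomp_tapp[OF assms(1)] sum.delta')
qed

lemma herm_decomp_hermitian:
  assumes "herm_decomp Is H m lam U" shows "hermitian Is H"
  using assms unfolding hermitian_def is_tensor_def herm_decomp_def orthonormal_fam_def
    is_vtensor_def outer_def hconj_def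
  by (auto simp: fun_eq_iff intro!: sum.cong sum.neutral)

text \<open>Tensors diagonal in one orthonormal family multiply eigenvalue by eigenvalue. This
  serves projections, the square inside \<open>tabs\<close> and the powers behind the
  traces.\<close>

lemma einstein_decomp:
  assumes A: "herm_decomp Is A m lam U" and B: "herm_decomp Is B m mu U"
  shows "herm_decomp Is (einstein Is A B) m (\<lambda>k. lam k * mu k) U"
proof -
  have on: "orthonormal_fam Is m U" using A by (simp add: herm_decomp_def)
  have "einstein Is A B i j = (\<Sum>k<m. complex_of_real (lam k * mu k) * outer (U k) (U k) i j)" for i j
  proof -
    have "einstein Is A B i j = tapp Is A (\<lambda>x. B x j) i"
      by (simp add: einstein_def tapp_def)
    also have "\<dots> = (\<Sum>k<m. complex_of_real (lam k) * tinner Is (\<lambda>x. B x j) (U k) * U k i)"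
      by (simp add: herm_decomp_tapp[OF A])
    also have "\<dots> = (\<Sum>k<m. complex_of_real (lam k * mu k) * outer (U k) (U k) i j)"
    proof (rule sum.cong)
      fix k assume "k \<in> {..<m}"
      then have k: "k < m" by simp
      have "tinner Is (\<lambda>x. B x j) (U k) = (\<Sum>x\<in>tidx Is. cnj (B j x * U k x))"
        by (simp add: tinner_def hermitian_cnj[OF herm_decomp_hermitian[OF B]])
      also have "\<dots> = cnj (tapp Is B (U k) j)" by (simp add: tapp_def)
      also have "\<dots> = mu k * cnj (U k j)" by (simp add: herm_decomp_eigen[OF B k])
      finally show "complex_of_real (lam k) * tinner Is (\<lambda>x. B x j) (U k) * U k i
          = complex_of_real (lam k * mu k) * outer (U k) (U k) i j"
        by (simp add: outer_def)
    qed simp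
    finally show ?thesis .
  qed
  then show ?thesis using on by (simp add: herm_decomp_def fun_eq_iff)
qed

text \<open>The orthogonal projection \<open>P\<close> onto the span has trace \<open>m\<close>;
  being Hermitian and idempotent, it has diagonal entries in [0,1], so the trace is at most the
  number of indices.\<close>

lemma orthonormal_fam_le_tsize:
  assumes on: "orthonormal_fam Is m U" shows "m \<le> tsize Is"
proof -
  define P where "P = (\<lambda>i j. \<Sum>k<m. complex_of_real 1 * outer (U k) (U k) i j)"
  have P: "herm_decomp Is P m (\<lambda>k. 1) U" using on by (simp add: herm_decomp_def P_def)
  have PP: "einstein Is P P = P"
    using einstein_decomp[OF P P] by (simp add: herm_decomp_def P_def)
  define d where "d = (\<lambda>i. \<Sum>k<m. (cmod (U k i))\<^sup>2)"
  have Pd: "P i i = complex_of_real (d i)" for i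
    by (simp add: P_def d_def outer_def complex_norm_square del: of_real_power)
  have d0: "d i \<ge> 0" for i by (simp add: d_def sum_nonneg)
  have "d i \<le> 1" if i: "i \<in> tidx Is" for i
  proof -
    have "complex_of_real (d i) = (\<Sum>j\<in>tidx Is. P i j * P j i)"
      using PP by (metis Pd einstein_def)
    also have "\<dots> = complex_of_real (\<Sum>j\<in>tidx Is. (cmod (P i j))\<^sup>2)"
      using hermitian_cnj[OF herm_decomp_hermitian[OF P]] by (simp add: complex_norm_square del: of_real_power)
    finally have "d i = (\<Sum>j\<in>tidx Is. (cmod (P i j))\<^sup>2)" using of_real_eq_iff by blast
    also have "\<dots> \<ge> (cmod (P i i))\<^sup>2" using i by (intro member_le_sum) auto
    finally have "d i * d i \<le> d i * 1" by (simp add: Pd power2_eq_square)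
    then show ?thesis using d0[of i] by (metis mult_le_cancel_left_pos less_eq_real_def zero_le_one)
  qed
  then have "(\<Sum>i\<in>tidx Is. d i) \<le> (\<Sum>i\<in>tidx Is. 1)" by (rule sum_mono)
  moreover have "(\<Sum>i\<in>tidx Is. d i) = (\<Sum>k<m. (vnorm Is (U k))\<^sup>2)"
    unfolding d_def vnorm_power2 by (rule sum.swap)
  moreover have "\<dots> = m" by (simp add: orthonormal_fam_vnorm[OF on])
  ultimately show ?thesis by (simp add: tsize_def)
qed

text \<open>The matrix of squared overlaps \<open>\<bar>\<langle>U\<^sub>k, V\<^sub>l\<rangle>\<bar>\<^sup>2\<close> vanishes unless the two eigenvalues agree, and
  its rows and columns belonging to nonzero eigenvalues sum to 1; counting it both ways
  compares the multiplicities.\<close>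

lemma herm_decomp_mult_unique:
  assumes A: "herm_decomp Is H m lam U" and B: "herm_decomp Is H n mu V" and x: "x \<noteq> 0"
  shows "card {k. k < m \<and> lam k = x} = card {l. l < n \<and> mu l = x}"
proof -
  define W where "W = (\<lambda>k l. (cmod (tinner Is (U k) (V l)))\<^sup>2)"
  have herm: "hermitian Is H" by (rule herm_decomp_hermitian[OF A])
  have ne: "mu l = lam k" if "k < m" "l < n" "W k l \<noteq> 0" for k l
  proof -
    have "complex_of_real (lam k) * tinner Is (U k) (V l) = tinner Is (tapp Is H (U k)) (V l)"
      by (simp add: herm_decomp_eigen[OF A] that tinner_scale_left)
    also have "\<dots> = tinner Is (U k) (tapp Is H (V l))" by (rule tinner_tapp[OF herm])
    also have "\<dots> = complex_of_real (mu l) * tinner Is (U k) (V l)"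
      by (simp add: herm_decomp_eigen[OF B] that tinner_scale_right)
    finally show ?thesis using that by (simp add: W_def)
  qed
  \<comment> \<open>The decompositions are bound afresh, so exchanging their roles also gives the
    row sums \<open>rW\<close>. As \<open>x \<noteq> 0\<close>, \<open>V l\<close> lies in the span
    of the \<open>U k\<close>, and the claim is Parseval's identity.\<close>
  have col: "(\<Sum>k<m. (cmod (tinner Is (U k) (V l)))\<^sup>2) = 1"
    if A: "herm_decomp Is H m lam U" and B: "herm_decomp Is H n mu V" and l: "l < n" "mu l = x"
    for m n :: nat and lam mu U V l
  proof -
    have onV: "orthonormal_fam Is n V" using B by (simp add: herm_decomp_def)
    have e: "complex_of_real (lam k) * tinner Is (V l) (U k) = x * tinner Is (V l) (U k)" if "k < m" for k
    proof -
      have "complex_of_real (lam k) * tinner Is (V l) (U k) = tinner Is (V l) (tapp Is H (U k))"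
        by (simp add: herm_decomp_eigen[OF A that] tinner_scale_right)
      also have "\<dots> = tinner Is (tapp Is H (V l)) (U k)" by (rule tinner_tapp[OF herm, symmetric])
      also have "\<dots> = x * tinner Is (V l) (U k)"
        by (simp add: herm_decomp_eigen[OF B] l tinner_scale_left)
      finally show ?thesis .
    qed
    have "complex_of_real x * V l i = complex_of_real x * (\<Sum>k<m. tinner Is (V l) (U k) * U k i)" for i
    proof -
      have "complex_of_real x * V l i = tapp Is H (V l) i"
        by (simp add: herm_decomp_eigen[OF B] l)
      also have "\<dots> = (\<Sum>k<m. complex_of_real x * tinner Is (V l) (U k) * U k i)"
        unfolding herm_decomp_tapp[OF A] using e by (intro sum.cong) auto
      finally show ?thesis by (simp add: sum_distrib_left mult.assoc)
    qed
    then have V: "V l = (\<lambda>i. \<Sum>k<m. tinner Is (V l) (U k) * U k i)" using x by auto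
    have "1 = tinner Is (V l) (V l)" using onV l by (simp add: orthonormal_fam_def)
    also have "\<dots> = (\<Sum>k<m. tinner Is (V l) (U k) * tinner Is (U k) (V l))"
      by (subst V) (rule tinner_sum_left)
    also have "\<dots> = complex_of_real (\<Sum>k<m. (cmod (tinner Is (U k) (V l)))\<^sup>2)"
      by (simp add: complex_norm_square tinner_cnj mult.commute del: of_real_power)
    finally show ?thesis by (metis of_real_eq_1_iff)
  qed
  have cW: "(\<Sum>k<m. W k l) = 1" if "l < n" "mu l = x" for l
    using col[OF A B that] by (simp add: W_def)
  have rW: "(\<Sum>l<n. W k l) = 1" if "k < m" "lam k = x" for k
  proof -
    have "cmod (tinner Is (U k) (V l)) = cmod (tinner Is (V l) (U k))" for l
      by (metis complex_mod_cnj tinner_cnj)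
    then show ?thesis using col[OF B A that] by (simp add: W_def)
  qed
  have "real (card {k. k < m \<and> lam k = x}) = (\<Sum>k\<in>{k. k < m \<and> lam k = x}. \<Sum>l<n. W k l)"
    using rW by simp
  also have "\<dots> = (\<Sum>k\<in>{k. k < m \<and> lam k = x}. \<Sum>l\<in>{l. l < n \<and> mu l = x}. W k l)"
    by (intro sum.cong[OF refl], intro sum.mono_neutral_right) (auto dest: ne)
  also have "\<dots> = (\<Sum>l\<in>{l. l < n \<and> mu l = x}. \<Sum>k\<in>{k. k < m \<and> lam k = x}. W k l)"
    by (rule sum.swap)
  also have "\<dots> = (\<Sum>l\<in>{l. l < n \<and> mu l = x}. \<Sum>k<m. W k l)"
    by (intro sum.cong[OF refl], intro sum.mono_neutral_left) (auto dest: ne)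
  also have "\<dots> = real (card {l. l < n \<and> mu l = x})" using cW by simp
  finally show ?thesis by simp
qed

subsection \<open>The spectral theorem\<close>

text \<open>\<open>is_vtensor\<close> forces every coordinate outside a finite index set to be 0, so
  the sphere is a closed subset of a product of compact sets and Tychonoff's theorem
  applies.\<close>

lemma compact_unit_sphere: "compact {x. is_vtensor Is x \<and> vnorm Is x = 1}"
proof -
  let ?S = "\<lambda>i. if i \<in> tidx Is then cball 0 1 else {0 :: complex}"
  have "compactin (product_topology (\<lambda>_. euclidean) UNIV) (PiE UNIV ?S)"
    by (subst compactin_PiE) simp
  then have cpt: "compact (PiE UNIV ?S)" by (simp add: euclidean_product_topology)
  have cls: "closed {x. vnorm Is x = 1}" unfolding vnorm_def
    by (intro closed_Collect_eq continuous_intros continuous_on_product_coordinates)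
  have "{x. is_vtensor Is x \<and> vnorm Is x = 1} = PiE UNIV ?S \<inter> {x. vnorm Is x = 1}"
  proof (intro equalityI subsetI)
    fix x assume x: "x \<in> {x. is_vtensor Is x \<and> vnorm Is x = 1}"
    have "cmod (x i) \<le> 1" if "i \<in> tidx Is" for i
    proof -
      have "(cmod (x i))\<^sup>2 \<le> (vnorm Is x)\<^sup>2"
        unfolding vnorm_power2 using that by (intro member_le_sum) auto
      then show ?thesis using x by (simp add: abs_square_le_1)
    qed
    with x show "x \<in> PiE UNIV ?S \<inter> {x. vnorm Is x = 1}"
      by (auto simp: is_vtensor_def)
  next
    fix x assume x: "x \<in> PiE UNIV ?S \<inter> {x. vnorm Is x = 1}"
    have "x i = 0" if "i \<notin> tidx Is" for i
      using x that PiE_mem[of x UNIV ?S i] by simp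
    with x show "x \<in> {x. is_vtensor Is x \<and> vnorm Is x = 1}"
      by (auto simp: is_vtensor_def)
  qed
  then show ?thesis using compact_Int_closed[OF cpt cls] by simp
qed

lemma tapp_basis:
  assumes "j \<in> tidx Is"
  shows "tapp Is H (\<lambda>i. if i = j then 1 else 0) = (\<lambda>i. H i j)"
  using assms by (simp add: tapp_def mult_delta_right)

text \<open>First-order condition: if \<open>a > 0\<close>, the linear term would dominate for small
  negative \<open>t\<close> and make the expression negative.\<close>

lemma linear_quadratic_nonneg_imp_zero:
  fixes a b :: real
  assumes "\<And>t. 2 * t * a + t\<^sup>2 * b \<ge> 0" "a \<ge> 0"
  shows "a = 0"
proof (rule ccontr)
  assume "a \<noteq> 0"
  then have a: "a > 0" using assms by simp
  \<comment> \<open>This size forces \<open>\<bar>t * b\<bar> \<le> a\<close>, so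
    \<open>2 * a + t * b\<close> stays positive.\<close>
  define t where "t = - a / (\<bar>b\<bar> + 1)"
  have t: "t < 0" using a by (simp add: t_def divide_neg_pos)
  have "t * (2 * a + t * b) \<ge> 0" using assms(1)[of t] by (simp add: power2_eq_square algebra_simps)
  then have "2 * a + t * b \<le> 0" using t by (simp add: zero_le_mult_iff)
  moreover have "\<bar>t * b\<bar> \<le> a"
  proof -
    have "\<bar>t * b\<bar> = a * (\<bar>b\<bar> / (\<bar>b\<bar> + 1))" using a by (simp add: t_def abs_mult)
    also have "\<dots> \<le> a * 1" using a by (intro mult_left_mono) (auto simp: divide_simps)
    finally show ?thesis by simp
  qed
  ultimately show False using a by linarith
qed

text \<open>A unit vector maximising \<open>\<parallel>Hx\<parallel>\<close>, with maximum \<open>M\<close>, satisfies \<open>H\<^sup>2v = M\<^sup>2v\<close>; as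
  \<open>(H + M)(H - M)v = 0\<close>, either \<open>v\<close> or \<open>Hv - Mv\<close> is an eigenvector, for \<open>M\<close> or \<open>-M\<close>.\<close>

lemma hermitian_nonzero_eigenvector:
  assumes H: "hermitian Is H" and nz: "H \<noteq> (\<lambda>i j. 0)"
  obtains v and mu :: real where "is_vtensor Is v" "vnorm Is v = 1" "mu \<noteq> 0"
    "tapp Is H v = (\<lambda>i. complex_of_real mu * v i)"
proof -
  have tH: "is_tensor Is H" using H by (simp add: hermitian_def)
  define S where "S = {x. is_vtensor Is x \<and> vnorm Is x = 1}"
  obtain i0 j0 where ij: "H i0 j0 \<noteq> 0" using nz by (auto simp: fun_eq_iff)
  then have i0: "i0 \<in> tidx Is" and j0: "j0 \<in> tidx Is" using tH by (auto simp: is_tensor_def)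
  define e where "e = (\<lambda>i. if i = j0 then 1 else (0::complex))"
  have "(vnorm Is e)\<^sup>2 = (\<Sum>i\<in>tidx Is. if i = j0 then 1 else 0)"
    unfolding vnorm_power2 e_def by (rule sum.cong) auto
  also have "\<dots> = 1" using j0 by simp
  finally have "vnorm Is e = 1" using vnorm_nonneg[of Is e] by (simp add: power2_eq_1_iff del: vnorm_nonneg)
  then have eS: "e \<in> S" using j0 by (simp add: S_def e_def is_vtensor_def)
  have "continuous_on S (\<lambda>x. vnorm Is (tapp Is H x))"
    unfolding vnorm_def tapp_def
    by (intro continuous_intros continuous_on_subset[OF continuous_on_product_coordinates]) auto
  then obtain v where v: "v \<in> S" and vmax: "\<And>x. x \<in> S \<Longrightarrow> vnorm Is (tapp Is H x) \<le> vnorm Is (tapp Is H v)"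
    using continuous_attains_sup[of S "\<lambda>x. vnorm Is (tapp Is H x)"] compact_unit_sphere[of Is] eS
    unfolding S_def by blast
  define M where "M = vnorm Is (tapp Is H v)"
  have vv: "is_vtensor Is v" "vnorm Is v = 1" using v by (auto simp: S_def)
  have M0: "M > 0"
  proof -
    have "tapp Is H e = (\<lambda>i. H i j0)" unfolding e_def by (rule tapp_basis[OF j0])
    then have "vnorm Is (tapp Is H e) \<noteq> 0"
      using vnorm_eq_0[OF is_vtensor_tapp[OF tH], of e] ij by (auto simp: fun_eq_iff)
    then show ?thesis using vmax[OF eS] vnorm_nonneg[of Is "tapp Is H e"]
      by (simp add: M_def del: vnorm_nonneg)
  qed
  have bnd: "vnorm Is (tapp Is H x) \<le> M * vnorm Is x" if x: "is_vtensor Is x" for x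
  proof (cases "vnorm Is x = 0")
    case True
    then show ?thesis using vnorm_eq_0[OF x] by (simp add: tapp_def vnorm_def)
  next
    case False
    then have p: "vnorm Is x > 0" using vnorm_nonneg[of Is x] by linarith
    define y where "y = (\<lambda>i. complex_of_real (1 / vnorm Is x) * x i)"
    have "y \<in> S" unfolding S_def y_def mem_Collect_eq vnorm_scale using x p
      by (auto simp: is_vtensor_def norm_divide)
    then have "vnorm Is (tapp Is H y) \<le> M" using vmax by (simp add: M_def)
    then show ?thesis using p unfolding y_def tapp_scale vnorm_scale
      by (simp add: norm_divide field_simps)
  qed
  define w where "w = (\<lambda>i. complex_of_real (M\<^sup>2) * v i - tapp Is H (tapp Is H v) i)"
  have w_vt: "is_vtensor Is w"
    using vv is_vtensor_tapp[OF tH] by (auto simp: is_vtensor_def w_def)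
  define R where "R = (\<lambda>x. Re (tinner Is x x))"
  have R: "R x = (vnorm Is x)\<^sup>2" for x by (simp add: R_def tinner_self_vnorm del: of_real_power)
  have expand: "R (\<lambda>i. x i + complex_of_real t * y i) = R x + 2 * t * Re (tinner Is x y) + t\<^sup>2 * R y" for x y t
  proof -
    have "Re (tinner Is z (\<lambda>i. x i + complex_of_real t * y i)) = Re (tinner Is z x) + t * Re (tinner Is z y)" for z
    proof -
      have "Re (tinner Is z (\<lambda>i. x i + complex_of_real t * y i))
          = Re (cnj (tinner Is (\<lambda>i. x i + complex_of_real t * y i) z))" by (simp only: tinner_cnj)
      also have "\<dots> = Re (cnj (tinner Is x z)) + t * Re (cnj (tinner Is y z))"
        by (simp add: tinner_add_left tinner_scale_left)
      finally show ?thesis by (simp only: tinner_cnj)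
    qed
    moreover have "Re (tinner Is y x) = Re (tinner Is x y)" by (metis cnj.simps(1) tinner_cnj)
    ultimately show ?thesis
      by (simp add: R_def tinner_add_left tinner_scale_left power2_eq_square algebra_simps)
  qed
  \<comment> \<open>Maximality compared at \<open>v + t w\<close>: the constant terms cancel because
    \<open>R v = 1\<close> and \<open>R (tapp Is H v) = M\<^sup>2\<close>, and self-adjointness
    makes the linear coefficient the squared norm of the defect \<open>w\<close> itself.\<close>
  have "2 * t * R w + t\<^sup>2 * (M\<^sup>2 * R w - R (tapp Is H w)) \<ge> 0" for t
  proof -
    let ?z = "\<lambda>i. v i + complex_of_real t * w i"
    have "is_vtensor Is ?z" using vv w_vt by (simp add: is_vtensor_def)
    then have "(vnorm Is (tapp Is H ?z))\<^sup>2 \<le> (M * vnorm Is ?z)\<^sup>2" by (intro power_mono bnd) auto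
    then have "R (tapp Is H ?z) \<le> M\<^sup>2 * R ?z" by (simp add: R power_mult_distrib)
    moreover have "tapp Is H ?z = (\<lambda>i. tapp Is H v i + complex_of_real t * tapp Is H w i)"
      by (simp add: tapp_add tapp_scale)
    ultimately have le: "R (tapp Is H v) + 2 * t * Re (tinner Is (tapp Is H v) (tapp Is H w)) + t\<^sup>2 * R (tapp Is H w)
      \<le> M\<^sup>2 * (R v + 2 * t * Re (tinner Is v w) + t\<^sup>2 * R w)"
      by (simp add: expand)
    have "R w = Re (tinner Is (\<lambda>i. complex_of_real (M\<^sup>2) * v i - tapp Is H (tapp Is H v) i) w)"
      by (simp add: R_def w_def)
    also have "\<dots> = M\<^sup>2 * Re (tinner Is v w) - Re (tinner Is (tapp Is H v) (tapp Is H w))"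
      by (simp add: tinner_diff_left tinner_scale_left tinner_tapp[OF H] del: of_real_power)
    finally have Rw: "R w = M\<^sup>2 * Re (tinner Is v w) - Re (tinner Is (tapp Is H v) (tapp Is H w))" .
    have "R v = 1" "R (tapp Is H v) = M\<^sup>2" by (simp_all add: R vv M_def)
    with le show ?thesis unfolding Rw by (simp add: algebra_simps)
  qed
  then have "R w = 0" by (rule linear_quadratic_nonneg_imp_zero) (simp add: R)
  then have "w = (\<lambda>i. 0)" using vnorm_eq_0[OF w_vt] by (simp add: R)
  then have HH: "tapp Is H (tapp Is H v) = (\<lambda>i. complex_of_real (M\<^sup>2) * v i)"
    by (simp add: w_def fun_eq_iff)
  define u where "u = (\<lambda>i. tapp Is H v i - complex_of_real M * v i)"
  have u_vt: "is_vtensor Is u"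
    using vv is_vtensor_tapp[OF tH] by (auto simp: is_vtensor_def u_def)
  show thesis
  proof (cases "u = (\<lambda>i. 0)")
    case True
    then have "tapp Is H v = (\<lambda>i. complex_of_real M * v i)" by (simp add: u_def fun_eq_iff)
    then show ?thesis using that[of v M] vv M0 by simp
  next
    case False
    then have p: "vnorm Is u > 0" using vnorm_eq_0[OF u_vt] vnorm_nonneg[of Is u] by linarith
    have Hu: "tapp Is H u = (\<lambda>i. complex_of_real (- M) * u i)"
      by (simp add: u_def tapp_diff tapp_scale HH fun_eq_iff algebra_simps power2_eq_square)
    show ?thesis
    proof (rule that[of "\<lambda>i. complex_of_real (1 / vnorm Is u) * u i" "- M"])
      show "vnorm Is (\<lambda>i. complex_of_real (1 / vnorm Is u) * u i) = 1"
        using p by (simp only: vnorm_scale) (simp add: norm_divide)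
      show "tapp Is H (\<lambda>i. complex_of_real (1 / vnorm Is u) * u i)
        = (\<lambda>i. complex_of_real (- M) * (complex_of_real (1 / vnorm Is u) * u i))"
        unfolding tapp_scale Hu by (simp add: fun_eq_iff)
    qed (use u_vt M0 in \<open>auto simp: is_vtensor_def\<close>)
  qed
qed

text \<open>A maximal orthonormal family of eigenvectors decomposes \<open>H\<close>: an eigenvector of the
  remainder for a nonzero eigenvalue would extend it.\<close>

theorem hermitian_decomp_exists:
  assumes H: "hermitian Is H"
  obtains m lam U where "herm_decomp Is H m lam U"
proof -
  define P where "P = (\<lambda>m. \<exists>lam U. orthonormal_fam Is m U \<and>
    (\<forall>k<m. tapp Is H (U k) = (\<lambda>i. complex_of_real (lam k) * U k i)))"
  have "P 0" by (simp add: P_def orthonormal_fam_def)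
  moreover have "P m \<Longrightarrow> m \<le> tsize Is" for m by (auto simp: P_def orthonormal_fam_le_tsize)
  ultimately obtain m where "P m" and mmax: "\<And>n. P n \<Longrightarrow> n \<le> m"
    using Nat.ex_has_greatest_nat[of P 0 "tsize Is"] by blast
  then obtain lam :: "nat \<Rightarrow> real" and U where on: "orthonormal_fam Is m U"
    and eig: "\<And>k. k < m \<Longrightarrow> tapp Is H (U k) = (\<lambda>i. complex_of_real (lam k) * U k i)"
    unfolding P_def by blast
  define G where "G = (\<lambda>i j. \<Sum>k<m. complex_of_real (lam k) * outer (U k) (U k) i j)"
  have G: "herm_decomp Is G m lam U" using on by (simp add: herm_decomp_def G_def)
  have hG: "hermitian Is G" by (rule herm_decomp_hermitian[OF G])
  define Q where "Q = (\<lambda>i j. H i j - G i j)"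
  have hQ: "hermitian Is Q"
    using H hG by (simp add: hermitian_def is_tensor_def hconj_def Q_def fun_eq_iff)
  have tQ: "tapp Is Q x = (\<lambda>i. tapp Is H x i - tapp Is G x i)" for x
    by (simp add: tapp_def Q_def left_diff_distrib sum_subtractf)
  have "Q = (\<lambda>i j. 0)"
  proof (rule ccontr)
    assume "Q \<noteq> (\<lambda>i j. 0)"
    from hermitian_nonzero_eigenvector[OF hQ this] obtain v and mu :: real
      where v: "is_vtensor Is v" "vnorm Is v = 1" and mu: "mu \<noteq> 0"
        and Qv: "tapp Is Q v = (\<lambda>i. complex_of_real mu * v i)" .
    \<comment> \<open>\<open>Q\<close> kills every \<open>U k\<close>, and eigenvectors of a
      Hermitian tensor for the distinct eigenvalues \<open>mu\<close> and 0 are orthogonal. Hence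
      \<open>G\<close> kills \<open>v\<close>, and \<open>v\<close> is an eigenvector of
      \<open>H\<close> as well.\<close>
    have orth: "tinner Is v (U k) = 0" if "k < m" for k
    proof -
      have "tapp Is Q (U k) = (\<lambda>i. 0)" unfolding tQ eig[OF that] herm_decomp_eigen[OF G that] by simp
      then have "tinner Is (tapp Is Q v) (U k) = 0"
        unfolding tinner_tapp[OF hQ] by (simp add: tinner_def)
      then show ?thesis using mu by (simp add: Qv tinner_scale_left)
    qed
    have orth': "tinner Is (U k) v = 0" if "k < m" for k
      using orth[OF that] tinner_cnj[of Is v "U k"] by simp
    have "tapp Is G v = (\<lambda>i. 0)" by (simp add: herm_decomp_tapp[OF G] orth)
    then have Hv: "tapp Is H v = (\<lambda>i. complex_of_real mu * v i)"
      using Qv by (simp add: tQ fun_eq_iff)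
    have "orthonormal_fam Is (Suc m) (U(m := v))"
      using on v orth orth' tinner_self_vnorm[of Is v]
      by (auto simp: orthonormal_fam_def less_Suc_eq)
    then have "P (Suc m)" unfolding P_def
      by (intro exI[of _ "lam(m := mu)"] exI[of _ "U(m := v)"]) (auto simp: less_Suc_eq eig Hv)
    then show False using mmax[of "Suc m"] by simp
  qed
  then have "H = G" by (simp add: Q_def fun_eq_iff)
  then show thesis using that G by simp
qed

subsection \<open>Eigenvalues of functions of a tensor\<close>

lemma herm_decomp_restrict_nonzero:
  assumes "herm_decomp Is H m lam U"
  obtains lam' U' where "herm_decomp Is H (card {k. k < m \<and> lam k \<noteq> 0}) lam' U'"
proof -
  define J where "J = {k. k < m \<and> lam k \<noteq> 0}"
  have "finite J" by (simp add: J_def)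
  then obtain h where h: "bij_betw h {..<card J} J"
    using ex_bij_betw_nat_finite[of J] by (auto simp: atLeast0LessThan)
  then have hJ: "h k \<in> J" if "k < card J" for k using that bij_betwE by blast
  have inj: "h k = h l \<longleftrightarrow> k = l" if "k < card J" "l < card J" for k l
    using h that by (auto simp: bij_betw_def inj_on_def)
  have on: "orthonormal_fam Is m U" using assms by (simp add: herm_decomp_def)
  have "orthonormal_fam Is (card J) (U \<circ> h)"
    using on hJ inj by (auto simp: orthonormal_fam_def J_def)
  moreover have "H i j = (\<Sum>k<card J. complex_of_real ((lam \<circ> h) k) * outer ((U \<circ> h) k) ((U \<circ> h) k) i j)" for i j
  proof -
    have "H i j = (\<Sum>k<m. complex_of_real (lam k) * outer (U k) (U k) i j)"
      using assms by (simp add: herm_decomp_def)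
    also have "\<dots> = (\<Sum>k\<in>J. complex_of_real (lam k) * outer (U k) (U k) i j)"
      by (rule sum.mono_neutral_right) (auto simp: J_def)
    finally show ?thesis by (simp add: sum.reindex_bij_betw[OF h, symmetric])
  qed
  ultimately show thesis using that unfolding herm_decomp_def J_def by blast
qed

text \<open>The spectral theorem makes the sets behind \<open>LEAST\<close> and \<open>SOME\<close>
  nonempty. A zero eigenvalue could be deleted, against the minimality of the rank.\<close>

lemma min_decomp:
  assumes "hermitian Is H"
  shows "herm_decomp Is H (herm_rank Is H) (fst (min_decomp Is H)) (snd (min_decomp Is H))"
    and "k < herm_rank Is H \<Longrightarrow> fst (min_decomp Is H) k \<noteq> 0"
proof -
  obtain m lam U where "herm_decomp Is H m lam U" using hermitian_decomp_exists[OF assms] .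
  then have "\<exists>lam U. herm_decomp Is H (herm_rank Is H) lam U"
    unfolding herm_rank_def using LeastI[of "\<lambda>r. \<exists>lam U. herm_decomp Is H r lam U"] by blast
  then show d: "herm_decomp Is H (herm_rank Is H) (fst (min_decomp Is H)) (snd (min_decomp Is H))"
    unfolding min_decomp_def
    using someI_ex[of "\<lambda>p. herm_decomp Is H (herm_rank Is H) (fst p) (snd p)"] by auto
  assume k: "k < herm_rank Is H"
  show "fst (min_decomp Is H) k \<noteq> 0"
  proof
    assume z: "fst (min_decomp Is H) k = 0"
    let ?J = "{k. k < herm_rank Is H \<and> fst (min_decomp Is H) k \<noteq> 0}"
    obtain lam U where "herm_decomp Is H (card ?J) lam U"
      using herm_decomp_restrict_nonzero[OF d] .
    then have "herm_rank Is H \<le> card ?J" unfolding herm_rank_def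
      by (intro Least_le) blast
    moreover have "card ?J < card {..<herm_rank Is H}"
      using k z by (intro psubset_card_mono) auto
    ultimately show False by simp
  qed
qed

lemma length_hevals [simp]: "length (hevals Is H) = herm_rank Is H"
  by (simp add: hevals_def)

lemma mset_hevals:
  "mset (hevals Is H) = image_mset (fst (min_decomp Is H)) (mset [0..<herm_rank Is H])"
  by (simp add: hevals_def)

lemma herm_rank_le_tsize: "hermitian Is H \<Longrightarrow> herm_rank Is H \<le> tsize Is"
  using min_decomp(1)[of Is H] orthonormal_fam_le_tsize[of Is "herm_rank Is H"]
  unfolding herm_decomp_def by blast

lemma count_image_mset_upt: "count (image_mset f (mset [0..<m])) x = card {k. k < m \<and> f k = x}"
proof (induction m)
  case (Suc m)
  have "{k. k < Suc m \<and> f k = x} =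
      (if f m = x then insert m {k. k < m \<and> f k = x} else {k. k < m \<and> f k = x})"
    by (auto simp: less_Suc_eq)
  then show ?case using Suc by simp
qed simp

text \<open>Makes the choice inside \<open>min_decomp\<close> irrelevant: multiplicities of nonzero
  values are unique, and the minimal decomposition has no zeros.\<close>

lemma mset_hevals_decomp:
  assumes A: "herm_decomp Is H m lam U"
  shows "mset (hevals Is H) = filter_mset (\<lambda>x. x \<noteq> 0) (image_mset lam (mset [0..<m]))"
proof (rule multiset_eqI)
  fix x
  have herm: "hermitian Is H" by (rule herm_decomp_hermitian[OF A])
  show "count (mset (hevals Is H)) x = count (filter_mset (\<lambda>x. x \<noteq> 0) (image_mset lam (mset [0..<m]))) x"
  proof (cases "x = 0")
    case True
    then have "{k. k < herm_rank Is H \<and> fst (min_decomp Is H) k = x} = {}"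
      using min_decomp(2)[OF herm] by auto
    then have "count (mset (hevals Is H)) x = 0" by (simp only: mset_hevals count_image_mset_upt card.empty)
    then show ?thesis using True by simp
  next
    case False
    then show ?thesis
      using herm_decomp_mult_unique[OF min_decomp(1)[OF herm] A False]
      by (simp only: mset_hevals count_image_mset_upt count_filter_mset) simp
  qed
qed

lemma tfun_decomp:
  assumes "hermitian Is H"
  shows "herm_decomp Is (tfun Is f H) (herm_rank Is H) (\<lambda>k. f (fst (min_decomp Is H) k)) (snd (min_decomp Is H))"
  using min_decomp(1)[OF assms] by (simp add: herm_decomp_def tfun_def)

text \<open>The filter accounts for eigenvalues at which \<open>f\<close> vanishes; each of them
  lowers the rank of \<open>tfun Is f H\<close>.\<close>

lemma mset_hevals_tfun:
  assumes "hermitian Is H"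
  shows "mset (hevals Is (tfun Is f H)) = filter_mset (\<lambda>x. x \<noteq> 0) (image_mset f (mset (hevals Is H)))"
  unfolding mset_hevals_decomp[OF tfun_decomp[OF assms]] by (simp add: mset_hevals image_mset.compositionality comp_def)

text \<open>The square of \<open>B\<close> has eigenvalues \<open>lam k * lam k\<close>, whose
  \<open>sqrt\<close> is the absolute value. Zeros are filtered out before and after
  \<open>sqrt\<close>, which amounts to once.\<close>

lemma mset_hevals_tabs:
  assumes A: "herm_decomp Is B m lam U"
  shows "mset (hevals Is (tabs Is B)) = filter_mset (\<lambda>x. x \<noteq> 0) (image_mset (\<lambda>k. \<bar>lam k\<bar>) (mset [0..<m]))"
proof -
  have "hconj B = B" using herm_decomp_hermitian[OF A] by (simp add: hermitian_def)
  then have E: "herm_decomp Is (einstein Is (hconj B) B) m (\<lambda>k. lam k * lam k) U"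
    using einstein_decomp[OF A A] by simp
  have "mset (hevals Is (tabs Is B))
      = filter_mset (\<lambda>x. x \<noteq> 0) (image_mset sqrt (filter_mset (\<lambda>x. x \<noteq> 0)
          (image_mset (\<lambda>k. lam k * lam k) (mset [0..<m]))))"
    unfolding tabs_def mset_hevals_tfun[OF herm_decomp_hermitian[OF E]] mset_hevals_decomp[OF E] ..
  also have "\<dots> = filter_mset (\<lambda>x. x \<noteq> 0) (image_mset (\<lambda>k. \<bar>lam k\<bar>) (mset [0..<m]))"
    by (simp add: filter_mset_image_mset filter_filter_mset image_mset.compositionality comp_def cong: filter_mset_cong conj_cong)
  finally show ?thesis .
qed

lemma mset_pad: "length xs \<le> n \<Longrightarrow> mset (pad xs n) = mset xs + replicate_mset (n - length xs) 0"
  by (simp add: pad_def)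

text \<open>Eigenvalues that \<open>f\<close> sends to 0 vanish from \<open>hevals\<close> but
  return as padding, so both arguments of \<open>\<rho>\<close> are permutations of each other.
  Since \<open>f\<close> is nonnegative, \<open>tabs\<close> leaves the values alone.\<close>

lemma ui_norm_tfun:
  assumes H: "hermitian Is H" and f: "\<And>x. f x \<ge> 0" and \<rho>: "sym_gauge (tsize Is) \<rho>"
  shows "ui_norm Is \<rho> (tfun Is f H) = \<rho> (pad (map f (hevals Is H)) (tsize Is))"
proof -
  let ?xs = "hevals Is (tabs Is (tfun Is f H))" and ?ys = "map f (hevals Is H)"
  have "mset ?xs = filter_mset (\<lambda>x. x \<noteq> 0) (mset ?ys)"
    unfolding mset_hevals_tabs[OF tfun_decomp[OF H]] by (simp add: mset_hevals f image_mset.compositionality comp_def)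
  then have "mset ?ys = mset ?xs + replicate_mset (count (mset ?ys) 0) 0"
    by (subst multiset_partition[of _ "\<lambda>x. x \<noteq> 0"]) (simp add: filter_eq_replicate_mset eq_commute)
  then obtain c where c: "mset ?ys = mset ?xs + replicate_mset c 0" ..
  have ly: "length ?ys \<le> tsize Is" using herm_rank_le_tsize[OF H] by simp
  have lx: "length ?ys = length ?xs + c" using arg_cong[OF c, of size] by simp
  have "mset (pad ?xs (tsize Is)) = mset (pad ?ys (tsize Is))"
    using lx ly mset_pad[OF ly] mset_pad[of ?xs "tsize Is"]
    unfolding c by (auto simp: multiset_eq_iff)
  moreover have "length (pad ?ys (tsize Is)) = tsize Is" using ly by (simp add: pad_def)
  ultimately show ?thesis using \<rho> unfolding ui_norm_def sym_gauge_def
    by (smt (verit) mset_eq_length)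
qed

subsection \<open>Symmetric gauge functions\<close>

lemma sym_gaugeD:
  assumes "sym_gauge n \<rho>" "length x = n"
  shows "\<rho> x \<ge> 0" "\<rho> (map (\<lambda>a. c * a) x) = \<bar>c\<bar> * \<rho> x"
    "length y = n \<Longrightarrow> \<rho> (map2 (+) x y) \<le> \<rho> x + \<rho> y"
    "mset x = mset y \<Longrightarrow> \<rho> x = \<rho> y" "\<rho> (map abs x) = \<rho> x"
  using assms unfolding sym_gauge_def by blast+

lemma sym_gauge_nonneg: "sym_gauge n \<rho> \<Longrightarrow> \<rho> (map x [0..<n]) \<ge> 0"
  by (simp add: sym_gaugeD)

lemma sym_gauge_scale: "sym_gauge n \<rho> \<Longrightarrow> \<rho> (map (\<lambda>i. c * x i) [0..<n]) = \<bar>c\<bar> * \<rho> (map x [0..<n])"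
proof -
  assume "sym_gauge n \<rho>"
  then have "\<rho> (map (\<lambda>a. c * a) (map x [0..<n])) = \<bar>c\<bar> * \<rho> (map x [0..<n])"
    by (rule sym_gaugeD) simp
  then show ?thesis by (simp add: comp_def)
qed

lemma sym_gauge_add:
  "sym_gauge n \<rho> \<Longrightarrow> \<rho> (map (\<lambda>i. x i + y i) [0..<n]) \<le> \<rho> (map x [0..<n]) + \<rho> (map y [0..<n])"
proof -
  assume "sym_gauge n \<rho>"
  then have "\<rho> (map2 (+) (map x [0..<n]) (map y [0..<n])) \<le> \<rho> (map x [0..<n]) + \<rho> (map y [0..<n])"
    by (rule sym_gaugeD) simp_all
  moreover have "map2 (+) (map x [0..<n]) (map y [0..<n]) = map (\<lambda>i. x i + y i) [0..<n]"
    by (rule nth_equalityI) auto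
  ultimately show ?thesis by simp
qed

lemma sym_gauge_abs:
  assumes "sym_gauge n \<rho>" "\<And>i. i < n \<Longrightarrow> \<bar>x i\<bar> = \<bar>y i\<bar>"
  shows "\<rho> (map x [0..<n]) = \<rho> (map y [0..<n])"
proof -
  have "\<rho> (map abs (map x [0..<n])) = \<rho> (map x [0..<n])" for x
    by (rule sym_gaugeD[OF assms(1)]) simp
  moreover have "map abs (map x [0..<n]) = map abs (map y [0..<n])" using assms(2) by simp
  ultimately show ?thesis by metis
qed

lemma sym_gauge_swap:
  assumes "sym_gauge n \<rho>" "i < n" "j < n"
  shows "\<rho> (map (x(i := x j, j := x i)) [0..<n]) = \<rho> (map x [0..<n])"
proof -
  have "map (x(i := x j, j := x i)) [0..<n]
      = (map x [0..<n])[i := map x [0..<n] ! j, j := map x [0..<n] ! i]"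
    using assms by (intro nth_equalityI) (auto simp: nth_list_update)
  also have "mset \<dots> = mset (map x [0..<n])" using assms by (intro mset_swap) auto
  finally show ?thesis by (intro sym_gaugeD(4)[OF assms(1)]) auto
qed

lemma sym_gauge_convex:
  assumes "sym_gauge n \<rho>" "0 \<le> t" "t \<le> 1"
  shows "\<rho> (map (\<lambda>i. (1 - t) * x i + t * y i) [0..<n]) \<le> (1 - t) * \<rho> (map x [0..<n]) + t * \<rho> (map y [0..<n])"
  using sym_gauge_add[OF assms(1), of "\<lambda>i. (1 - t) * x i" "\<lambda>i. t * y i"] assms
  by (simp add: sym_gauge_scale)

lemma map_upt_if: "map (\<lambda>i. if i < n then x i else y i) [0..<n] = map x [0..<n]"
  by simp

text \<open>\<open>x(k := a)\<close> is a convex combination of \<open>x\<close> and of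
  \<open>x\<close> with the sign of entry \<open>k\<close> flipped, and these two have the same
  gauge.\<close>

lemma sym_gauge_mono1:
  assumes \<rho>: "sym_gauge n \<rho>" and a: "\<bar>a\<bar> \<le> \<bar>x k\<bar>"
  shows "\<rho> (map (x(k := a)) [0..<n]) \<le> \<rho> (map x [0..<n])"
proof (cases "x k = 0")
  case True
  then show ?thesis using a by (simp add: fun_upd_idem)
next
  case False
  \<comment> \<open>Solves \<open>(1 - 2 * t) * x k = a\<close>.\<close>
  define t where "t = (1 - a / x k) / 2"
  have "\<bar>a / x k\<bar> \<le> 1" using a False by (simp add: abs_divide)
  then have "- 1 \<le> a / x k" "a / x k \<le> 1" by (simp_all only: abs_le_iff) linarith
  then have t: "0 \<le> t" "t \<le> 1" by (auto simp: t_def)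
  have "(1 - t) * x k + t * (- x k) = a" using False by (simp add: t_def field_simps)
  then have eq: "x(k := a) = (\<lambda>i. (1 - t) * x i + t * (x(k := - x k)) i)"
    by (auto simp: fun_eq_iff algebra_simps)
  have "\<rho> (map (x(k := a)) [0..<n]) \<le> (1 - t) * \<rho> (map x [0..<n]) + t * \<rho> (map (x(k := - x k)) [0..<n])"
    unfolding eq by (rule sym_gauge_convex[OF \<rho> t])
  also have "\<rho> (map (x(k := - x k)) [0..<n]) = \<rho> (map x [0..<n])"
    by (rule sym_gauge_abs[OF \<rho>]) auto
  also have "(1 - t) * \<rho> (map x [0..<n]) + t * \<rho> (map x [0..<n]) = \<rho> (map x [0..<n])"
    by (simp add: algebra_simps)
  finally show ?thesis .
qed

lemma sym_gauge_mono:
  assumes \<rho>: "sym_gauge n \<rho>" and le: "\<And>i. i < n \<Longrightarrow> \<bar>x i\<bar> \<le> \<bar>y i\<bar>"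
  shows "\<rho> (map x [0..<n]) \<le> \<rho> (map y [0..<n])"
proof -
  have "k \<le> n \<Longrightarrow> \<rho> (map (\<lambda>i. if i < k then x i else y i) [0..<n]) \<le> \<rho> (map y [0..<n])" for k
  proof (induction k)
    case (Suc k)
    let ?z = "\<lambda>i. if i < k then x i else y i"
    have "(\<lambda>i. if i < Suc k then x i else y i) = ?z(k := x k)"
      by (auto simp: fun_eq_iff less_Suc_eq)
    then have "\<rho> (map (\<lambda>i. if i < Suc k then x i else y i) [0..<n]) \<le> \<rho> (map ?z [0..<n])"
      using sym_gauge_mono1[OF \<rho>, of "x k" ?z k] le[of k] Suc by simp
    then show ?case using Suc by simp
  qed simp
  from this[of n] show ?thesis by (simp add: map_upt_if)
qed

text \<open>Moving mass from a larger entry to a smaller one gives a convex combination of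
  \<open>y\<close> and of \<open>y\<close> with the two entries exchanged; the exchange does not
  change \<open>\<rho>\<close>.\<close>

lemma sym_gauge_transfer:
  assumes \<rho>: "sym_gauge n \<rho>" and ij: "i < n" "j < n" "i \<noteq> j" and d: "0 \<le> d" "d \<le> y i - y j"
  shows "\<rho> (map (y(i := y i - d, j := y j + d)) [0..<n]) \<le> \<rho> (map y [0..<n])"
proof (cases "y i = y j")
  case True
  then have "y(i := y i - d, j := y j + d) = y" using d by (simp add: fun_eq_iff)
  then show ?thesis by simp
next
  case False
  then have p: "y i - y j > 0" using d by simp
  define t where "t = d / (y i - y j)"
  have t: "0 \<le> t" "t \<le> 1" using d p by (auto simp: t_def)
  have td: "t * (y i - y j) = d" using p by (simp add: t_def)
  have "y(i := y i - d, j := y j + d) = (\<lambda>k. (1 - t) * y k + t * (y(i := y j, j := y i)) k)"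
    using ij td by (auto simp: fun_eq_iff algebra_simps)
  note eq = this
  have "\<rho> (map (y(i := y i - d, j := y j + d)) [0..<n])
      \<le> (1 - t) * \<rho> (map y [0..<n]) + t * \<rho> (map (y(i := y j, j := y i)) [0..<n])"
    unfolding eq by (rule sym_gauge_convex[OF \<rho> t])
  also have "\<dots> = \<rho> (map y [0..<n])"
    unfolding sym_gauge_swap[OF \<rho> ij(1,2)] by (simp add: algebra_simps)
  finally show ?thesis .
qed

text \<open>A transfer is noticed only by partial sums containing position \<open>i\<close> but not
  \<open>j\<close>; only there could majorisation be lost.\<close>

lemma sum_transfer:
  fixes y :: "nat \<Rightarrow> real"
  assumes "i < j"
  shows "(\<Sum>l<k. (y(i := y i - d, j := y j + d)) l)
    = (\<Sum>l<k. y l) - (if i < k \<and> k \<le> j then d else 0)"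
  proof (induction k)
  case (Suc k)
  consider "k < i" | "k = i" | "i < k" "k < j" | "k = j" | "j < k" by linarith
  then show ?case using Suc assms by cases auto
qed simp

text \<open>Induction on the number of positions where \<open>x\<close> and \<open>y\<close> differ. If \<open>x j > y j\<close> for a first \<open>j\<close>,
  take the last \<open>i < j\<close> with \<open>x i < y i\<close> and move mass from \<open>y i\<close> to \<open>y j\<close> until one of the two
  entries agrees with that of \<open>x\<close>.\<close>

lemma sym_gauge_weak_maj_mono:
  assumes \<rho>: "sym_gauge n \<rho>"
    and dec: "\<And>i j. i \<le> j \<Longrightarrow> j < n \<Longrightarrow> x j \<le> x i"
    and nonneg: "\<And>i. i < n \<Longrightarrow> 0 \<le> x i"
    and maj: "\<And>k. k \<le> n \<Longrightarrow> (\<Sum>i<k. x i) \<le> (\<Sum>i<k. y i)"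
  shows "\<rho> (map x [0..<n]) \<le> \<rho> (map y [0..<n])"
  using maj
proof (induction "card {i. i < n \<and> x i \<noteq> y i}" arbitrary: y rule: less_induct)
  case less
  show ?case
  proof (cases "\<exists>j<n. y j < x j")
    case False
    then show ?thesis
      using nonneg by (intro sym_gauge_mono[OF \<rho>])
        (metis abs_ge_self abs_of_nonneg not_less order_trans)
  next
    case True
    define j where "j = (LEAST j. j < n \<and> y j < x j)"
    have j: "j < n" "y j < x j" using LeastI_ex[OF True] by (auto simp: j_def)
    have jmin: "x i \<le> y i" if "i < j" for i
      using not_less_Least[of i "\<lambda>j. j < n \<and> y j < x j"] that j(1) by (auto simp: j_def)
    \<comment> \<open>Otherwise \<open>x\<close> and \<open>y\<close> agree before \<open>j\<close>,
      and \<open>y j < x j\<close> breaks majorisation at \<open>Suc j\<close>.\<close>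
    have "\<exists>i<j. x i < y i"
    proof (rule ccontr)
      assume "\<not> (\<exists>i<j. x i < y i)"
      then have "(\<Sum>i<j. y i) \<le> (\<Sum>i<j. x i)" by (intro sum_mono) (metis lessThan_iff not_less)
      then have "(\<Sum>i<Suc j. y i) < (\<Sum>i<Suc j. x i)" using j by simp
      then show False using less.prems[of "Suc j"] j by simp
    qed
    then obtain i where i: "i < j" "x i < y i" and imax: "\<And>k. k < j \<Longrightarrow> x k < y k \<Longrightarrow> k \<le> i"
      using Nat.ex_has_greatest_nat[of "\<lambda>i. i < j \<and> x i < y i" _ j] by (metis less_imp_le)
    have eq: "x k = y k" if "i < k" "k < j" for k
      using jmin[of k] imax[of k] that by force
    define d where "d = min (y i - x i) (x j - y j)"
    have d: "d > 0" "d \<le> y i - x i" "d \<le> x j - y j" using i j by (auto simp: d_def)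
    \<comment> \<open>The transfer needs \<open>d \<le> y i - y j\<close>. The decreasing order of
      \<open>x\<close> gives it:
      \<open>d \<le> y i - x i \<le> y i - x j < y i - y j\<close>.\<close>
    have xij: "x j \<le> x i" using dec[of i j] i j by simp
    define z where "z = y(i := y i - d, j := y j + d)"
    have "\<rho> (map z [0..<n]) \<le> \<rho> (map y [0..<n])"
      unfolding z_def using i j d xij by (intro sym_gauge_transfer[OF \<rho>]) auto
    moreover have "\<rho> (map x [0..<n]) \<le> \<rho> (map z [0..<n])"
    proof (rule less.hyps)
      have sub: "{i. i < n \<and> x i \<noteq> z i} \<subseteq> {i. i < n \<and> x i \<noteq> y i}"
        using i j by (auto simp: z_def)
      have "i \<in> {i. i < n \<and> x i \<noteq> y i}" "j \<in> {i. i < n \<and> x i \<noteq> y i}" using i j by auto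
      moreover have "x i = z i \<or> x j = z j" using i j by (auto simp: z_def d_def min_def)
      ultimately have "{i. i < n \<and> x i \<noteq> z i} \<subset> {i. i < n \<and> x i \<noteq> y i}" using sub by blast
      then show "card {i. i < n \<and> x i \<noteq> z i} < card {i. i < n \<and> x i \<noteq> y i}"
        by (intro psubset_card_mono) auto
    next
      fix k assume k: "k \<le> n"
      show "(\<Sum>l<k. x l) \<le> (\<Sum>l<k. z l)"
      proof (cases "i < k \<and> k \<le> j")
        case False
        then show ?thesis using less.prems[OF k] unfolding z_def sum_transfer[OF i(1)] by auto
      next
        case True
        \<comment> \<open>All terms \<open>y l - x l\<close> before \<open>k\<close> are
          nonnegative, since \<open>j\<close> is the first violation, so the term at
          \<open>i\<close> alone pays for the loss \<open>d\<close>.\<close>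
        have "d \<le> y i - x i" by (rule d)
        also have "\<dots> \<le> (\<Sum>l<k. y l - x l)"
          using True jmin by (intro member_le_sum[of i "{..<k}" "\<lambda>l. y l - x l"]) auto
        finally show ?thesis using True unfolding z_def sum_transfer[OF i(1)] sum_subtractf by simp
      qed
    qed
    ultimately show ?thesis by simp
  qed
qed

section \<open>Supporting functionals and Jensen's inequality for gauge functions\<close>

definition sublinear :: "((nat \<Rightarrow> real) \<Rightarrow> real) \<Rightarrow> bool" where
  "sublinear p \<longleftrightarrow> (\<forall>x y. p (\<lambda>i. x i + y i) \<le> p x + p y) \<and> (\<forall>c\<ge>0. \<forall>x. p (\<lambda>i. c * x i) = c * p x)"

lemma sublinear_add: "sublinear p \<Longrightarrow> p (\<lambda>i. x i + y i) \<le> p x + p y"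
  and sublinear_scale: "sublinear p \<Longrightarrow> c \<ge> 0 \<Longrightarrow> p (\<lambda>i. c * x i) = c * p x"
  by (auto simp: sublinear_def)

lemma sublinear_zero: "sublinear p \<Longrightarrow> p (\<lambda>i. 0) = 0"
  using sublinear_scale[of p 0 "\<lambda>i. 0"] by simp

lemma sublinear_minus: "sublinear p \<Longrightarrow> - p (\<lambda>i. - x i) \<le> p x"
  using sublinear_add[of p x "\<lambda>i. - x i"] by (simp add: sublinear_zero)

text \<open>The sublinear minorant \<open>z \<mapsto> inf {p (z + t u) - t p u | t \<ge> 0}\<close> is linear along \<open>u\<close>.\<close>

lemma sublinear_minorant:
  assumes p: "sublinear p"
  obtains q where "sublinear q" "\<And>z. q z \<le> p z" "q (\<lambda>i. - u i) \<le> - p u"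
proof -
  define F where "F = (\<lambda>z t. p (\<lambda>i. z i + t * u i) - t * p u)"
  define q where "q = (\<lambda>z. Inf (F z ` {0..}))"
  \<comment> \<open>A lower bound uniform in \<open>t\<close>, which makes the infimum a genuine
    one.\<close>
  have lb: "- p (\<lambda>i. - z i) \<le> F z t" if "t \<ge> 0" for z t
  proof -
    have "t * p u = p (\<lambda>i. t * u i)" using sublinear_scale[OF p that] by simp
    also have "\<dots> \<le> p (\<lambda>i. z i + t * u i) + p (\<lambda>i. - z i)"
      using sublinear_add[OF p, of "\<lambda>i. z i + t * u i" "\<lambda>i. - z i"] by simp
    finally show ?thesis by (simp add: F_def)
  qed
  have ql: "q z \<le> F z t" if "t \<ge> 0" for z t
    unfolding q_def using lb that by (intro cInf_lower bdd_belowI2) auto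
  have qg: "c \<le> q z" if "\<And>t. t \<ge> 0 \<Longrightarrow> c \<le> F z t" for c z
    unfolding q_def using that by (intro cInf_greatest) auto
  have scale: "q (\<lambda>i. c * z i) \<le> c * q z" if c: "c > 0" for c z
  proof -
    have "q (\<lambda>i. c * z i) / c \<le> q z"
    proof (rule qg)
      fix t :: real assume t: "t \<ge> 0"
      have "q (\<lambda>i. c * z i) \<le> F (\<lambda>i. c * z i) (c * t)" using t c by (intro ql) simp
      also have "\<dots> = c * F z t"
        using sublinear_scale[OF p, of c "\<lambda>i. z i + t * u i"] c by (simp add: F_def algebra_simps)
      finally show "q (\<lambda>i. c * z i) / c \<le> F z t" using c by (simp add: divide_le_eq mult.commute)
    qed
    then show ?thesis using c by (simp add: divide_le_eq mult.commute)
  qed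
  have q0: "q (\<lambda>i. 0) = 0"
  proof (rule antisym)
    show "q (\<lambda>i. 0) \<le> 0" using ql[of 0 "\<lambda>i. 0"] by (simp add: F_def sublinear_zero[OF p])
    show "0 \<le> q (\<lambda>i. 0)" using lb[of _ "\<lambda>i. 0"] by (intro qg) (simp add: sublinear_zero[OF p])
  qed
  have "sublinear q"
    unfolding sublinear_def
  proof (intro conjI allI impI)
    fix x y
    have "q (\<lambda>i. x i + y i) - F y t \<le> q x" if t: "t \<ge> 0" for t
    proof (rule qg)
      fix s :: real assume s: "s \<ge> 0"
      have "q (\<lambda>i. x i + y i) \<le> F (\<lambda>i. x i + y i) (s + t)" using s t by (intro ql) simp
      also have "\<dots> \<le> F x s + F y t"
        using sublinear_add[OF p, of "\<lambda>i. x i + s * u i" "\<lambda>i. y i + t * u i"]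
        by (simp add: F_def algebra_simps)
      finally show "q (\<lambda>i. x i + y i) - F y t \<le> F x s" by simp
    qed
    then have "q (\<lambda>i. x i + y i) - q x \<le> q y" by (intro qg) (simp add: algebra_simps)
    then show "q (\<lambda>i. x i + y i) \<le> q x + q y" by simp
  next
    fix c :: real and x :: "nat \<Rightarrow> real" assume c: "0 \<le> c"
    show "q (\<lambda>i. c * x i) = c * q x"
    proof (cases "c = 0")
      case True then show ?thesis by (simp add: q0)
    next
      case False
      then have c: "c > 0" using c by simp
      have "q x \<le> (1 / c) * q (\<lambda>i. c * x i)" using scale[of "1/c" "\<lambda>i. c * x i"] c by simp
      then have "c * q x \<le> q (\<lambda>i. c * x i)" using c by (simp add: field_simps)
      then show ?thesis using scale[OF c, of x] by simp
    qed
  qed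
  moreover have "q z \<le> p z" for z using ql[of 0 z] by (simp add: F_def)
  moreover have "q (\<lambda>i. - u i) \<le> - p u"
    using ql[of 1 "\<lambda>i. - u i"] by (simp add: F_def sublinear_zero[OF p])
  ultimately show thesis by (rule that)
qed

text \<open>Finite-dimensional Hahn-Banach: \<open>p\<close> is lowered along \<open>x\<close> and
  then along each unit vector. Lowering along \<open>u\<close> yields
  \<open>q (- u) \<le> - q u\<close>, which makes \<open>q\<close> linear on that line; in the end
  \<open>q\<close> is linear in the first \<open>n\<close> entries, and the first lowering has
  pinned its value at \<open>x\<close> to \<open>p x\<close>.\<close>

lemma sublinear_support:
  assumes p: "sublinear p" and dep: "\<And>z. p (\<lambda>i. if i < n then z i else 0) = p z"
  obtains c where "\<And>z. (\<Sum>i<n. c i * z i) \<le> p z" "(\<Sum>i<n. c i * x i) = p x"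
proof -
  define e where "e = (\<lambda>k i. if i = (k :: nat) then 1 else 0 :: real)"
  have "\<exists>q. sublinear q \<and> (\<forall>z. q z \<le> p z) \<and> q (\<lambda>i. - x i) \<le> - p x \<and>
      (\<forall>k<m. q (\<lambda>i. - e k i) \<le> - q (e k))" for m :: nat
  proof (induction m)
    case 0
    obtain q where "sublinear q" "\<And>z. q z \<le> p z" "q (\<lambda>i. - x i) \<le> - p x"
      using sublinear_minorant[OF p] by blast
    then show ?case by auto
  next
    case (Suc m)
    then obtain q where q: "sublinear q" "\<And>z. q z \<le> p z" "q (\<lambda>i. - x i) \<le> - p x"
      and qe: "\<And>k. k < m \<Longrightarrow> q (\<lambda>i. - e k i) \<le> - q (e k)" by auto
    obtain q' where q': "sublinear q'" "\<And>z. q' z \<le> q z" "q' (\<lambda>i. - e m i) \<le> - q (e m)"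
      using sublinear_minorant[OF q(1), of "e m"] by blast
    \<comment> \<open>Linearity along earlier directions survives further lowering:
      \<open>q' (- u) \<le> q (- u) \<le> - q u \<le> - q' u\<close>.\<close>
    have "q' (\<lambda>i. - e k i) \<le> - q' (e k)" if "k < Suc m" for k
      using that qe[of k] q'(2)[of "\<lambda>i. - e k i"] q'(2)[of "e k"] q'(3) by (cases "k = m") auto
    moreover have "q' z \<le> p z" for z using q'(2) q(2) order_trans by blast
    moreover have "q' (\<lambda>i. - x i) \<le> - p x" using q'(2) q(3) order_trans by blast
    ultimately show ?case using q'(1) by blast
  qed
  from this[of n] obtain q where q: "sublinear q" "\<And>z. q z \<le> p z" "q (\<lambda>i. - x i) \<le> - p x"
    and qe: "\<And>k. k < n \<Longrightarrow> q (\<lambda>i. - e k i) \<le> - q (e k)" by auto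
  have te: "q (\<lambda>i. t * e k i) \<le> q (e k) * t" if "k < n" for k t
  proof (cases "t \<ge> 0")
    case True
    then show ?thesis by (simp add: sublinear_scale[OF q(1)] mult.commute)
  next
    case False
    then have "q (\<lambda>i. (- t) * (- e k i)) = (- t) * q (\<lambda>i. - e k i)"
      by (intro sublinear_scale[OF q(1)]) simp
    also have "\<dots> \<le> (- t) * (- q (e k))" using False qe[OF that] by (intro mult_left_mono) auto
    finally show ?thesis by (simp add: mult.commute)
  qed
  define tr where "tr = (\<lambda>k z (i :: nat). if i < k then z i else 0 :: real)"
  have up: "k \<le> n \<Longrightarrow> q (tr k z) \<le> (\<Sum>i<k. q (e i) * z i)" for k z
  proof (induction k)
    case 0
    then show ?case by (simp add: tr_def sublinear_zero[OF q(1)])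
  next
    case (Suc k)
    have "tr (Suc k) z = (\<lambda>i. tr k z i + z k * e k i)" by (auto simp: tr_def e_def fun_eq_iff less_Suc_eq)
    then have "q (tr (Suc k) z) \<le> q (tr k z) + q (\<lambda>i. z k * e k i)"
      using sublinear_add[OF q(1)] by simp
    then show ?case using Suc te[of k "z k"] by simp
  qed
  have le: "(\<Sum>i<n. q (e i) * z i) \<le> p z" for z
  proof -
    have "q (\<lambda>i. - tr n z i) \<le> (\<Sum>i<n. q (e i) * (- z i))"
      using up[of n "\<lambda>i. - z i"] by (simp add: tr_def if_distrib cong: if_cong)
    then have "(\<Sum>i<n. q (e i) * z i) \<le> - q (\<lambda>i. - tr n z i)" by (simp add: sum_negf)
    also have "\<dots> \<le> p (tr n z)" using sublinear_minus[OF q(1)] q(2) order_trans by blast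
    finally show ?thesis using dep[of z] by (simp add: tr_def)
  qed
  \<comment> \<open>\<open>x\<close> and its truncation may differ from \<open>n\<close> on;
    \<open>p\<close> vanishes on that difference and on its negative, so \<open>q\<close> is at most
    0 on both.\<close>
  have "p x \<le> (\<Sum>i<n. q (e i) * x i)"
  proof -
    have "q (\<lambda>i. tr n x i - x i) \<le> p (\<lambda>i. tr n x i - x i)" by (rule q(2))
    also have "\<dots> = p (\<lambda>i. 0)"
      by (subst dep[symmetric]) (rule arg_cong[where f = p], auto simp: tr_def)
    finally have "q (\<lambda>i. tr n x i - x i) \<le> 0" by (simp add: sublinear_zero[OF p])
    moreover have "q (\<lambda>i. - (tr n x i - x i)) + q (\<lambda>i. tr n x i - x i) \<ge> 0"
      using sublinear_minus[OF q(1), of "\<lambda>i. tr n x i - x i"] by simp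
    moreover have "q (\<lambda>i. - x i) \<ge> - q x" using sublinear_minus[OF q(1), of x] by simp
    moreover have "q x \<le> q (tr n x) + q (\<lambda>i. - (tr n x i - x i))"
      using sublinear_add[OF q(1), of "tr n x" "\<lambda>i. - (tr n x i - x i)"] by simp
    moreover have "q (\<lambda>i. - (tr n x i - x i)) \<le> p (\<lambda>i. - (tr n x i - x i))" by (rule q(2))
    moreover have "p (\<lambda>i. - (tr n x i - x i)) = p (\<lambda>i. 0)"
      by (subst dep[symmetric]) (rule arg_cong[where f = p], auto simp: tr_def)
    ultimately show ?thesis using up[of n x] q(3) by (simp add: sublinear_zero[OF p])
  qed
  with le[of x] have "(\<Sum>i<n. q (e i) * x i) = p x" by simp
  with le show thesis by (rule that)
qed

lemma sublinear_sym_gauge: "sym_gauge n \<rho> \<Longrightarrow> sublinear (\<lambda>x. \<rho> (map x [0..<n]))"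
  by (simp add: sublinear_def sym_gauge_add sym_gauge_scale)

text \<open>The supporting functional at the mean vector commutes with the integral, agrees with
  \<open>\<rho>\<close> at the mean and lies below it elsewhere.\<close>

lemma sym_gauge_jensen:
  assumes \<rho>: "sym_gauge n \<rho>"
    and X: "\<And>i. i < n \<Longrightarrow> integrable M (X i)"
    and int: "integrable M (\<lambda>t. \<rho> (map (\<lambda>i. X i t) [0..<n]))"
  shows "\<rho> (map (\<lambda>i. \<integral>t. X i t \<partial>M) [0..<n]) \<le> (\<integral>t. \<rho> (map (\<lambda>i. X i t) [0..<n]) \<partial>M)"
proof -
  obtain c where c: "\<And>z. (\<Sum>i<n. c i * z i) \<le> \<rho> (map z [0..<n])"
    "(\<Sum>i<n. c i * (\<integral>t. X i t \<partial>M)) = \<rho> (map (\<lambda>i. \<integral>t. X i t \<partial>M) [0..<n])"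
    using sublinear_support[OF sublinear_sym_gauge[OF \<rho>], of n "\<lambda>i. \<integral>t. X i t \<partial>M"]
    by (auto simp: map_upt_if)
  have "(\<Sum>i<n. c i * (\<integral>t. X i t \<partial>M)) = (\<integral>t. (\<Sum>i<n. c i * X i t) \<partial>M)"
    using X by simp
  also have "\<dots> \<le> (\<integral>t. \<rho> (map (\<lambda>i. X i t) [0..<n]) \<partial>M)"
    using X c(1) by (intro integral_mono int) auto
  finally show ?thesis by (simp add: c(2))
qed

text \<open>Triangle inequality along the coordinate axes. It supplies the Lipschitz bound for
  continuity and the constant that makes gauges of bounded families integrable.\<close>

lemma sym_gauge_le_sum:
  assumes \<rho>: "sym_gauge n \<rho>"
  shows "\<rho> (map x [0..<n]) \<le> (\<Sum>i<n. \<bar>x i\<bar> * \<rho> (map (\<lambda>j. if j = i then 1 else 0) [0..<n]))"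
proof -
  have "k \<le> n \<Longrightarrow> \<rho> (map (\<lambda>i. if i < k then x i else 0) [0..<n])
      \<le> (\<Sum>i<k. \<bar>x i\<bar> * \<rho> (map (\<lambda>j. if j = i then 1 else 0) [0..<n]))" for k
  proof (induction k)
    case 0
    show ?case using sym_gauge_scale[OF \<rho>, of 0] by simp
  next
    case (Suc k)
    have "(\<lambda>i. if i < Suc k then x i else 0) =
        (\<lambda>i. (if i < k then x i else 0) + x k * (if i = k then 1 else 0))"
      by (auto simp: fun_eq_iff less_Suc_eq)
    then show ?case using Suc
      sym_gauge_add[OF \<rho>, of "\<lambda>i. if i < k then x i else 0" "\<lambda>i. x k * (if i = k then 1 else 0)"]
      by (simp only: sym_gauge_scale[OF \<rho>]) simp
  qed
  from this[of n] show ?thesis by (simp add: map_upt_if)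
qed

lemma continuous_on_sym_gauge:
  assumes \<rho>: "sym_gauge n \<rho>"
  shows "continuous_on UNIV (\<lambda>x. \<rho> (map x [0..<n]))"
  unfolding continuous_on_def
proof (intro ballI, simp)
  fix x :: "nat \<Rightarrow> real"
  let ?G = "\<lambda>x. \<rho> (map x [0..<n])"
  let ?K = "\<lambda>i. \<rho> (map (\<lambda>j. if j = i then 1 else 0) [0..<n])"
  have bound: "norm (?G y - ?G x) \<le> (\<Sum>i<n. \<bar>y i - x i\<bar> * ?K i)" for y
  proof -
    have "?G y \<le> ?G x + ?G (\<lambda>i. y i - x i)" "?G x \<le> ?G y + ?G (\<lambda>i. x i - y i)"
      using sym_gauge_add[OF \<rho>, of x "\<lambda>i. y i - x i"] sym_gauge_add[OF \<rho>, of y "\<lambda>i. x i - y i"]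
      by simp_all
    moreover have "?G (\<lambda>i. x i - y i) = ?G (\<lambda>i. y i - x i)" by (rule sym_gauge_abs[OF \<rho>]) auto
    ultimately have "norm (?G y - ?G x) \<le> ?G (\<lambda>i. y i - x i)" by simp
    then show ?thesis using sym_gauge_le_sum[OF \<rho>] order_trans by blast
  qed
  have tc: "((\<lambda>y. y i) \<longlongrightarrow> x i) (at x)" for i
    using continuous_on_product_coordinates[of i] by (auto simp: continuous_on_def)
  have "((\<lambda>y. \<Sum>i<n. \<bar>y i - x i\<bar> * ?K i) \<longlongrightarrow> (\<Sum>i<n. \<bar>x i - x i\<bar> * ?K i)) (at x)"
    by (intro tendsto_intros tc)
  then have lim: "((\<lambda>y. \<Sum>i<n. \<bar>y i - x i\<bar> * ?K i) \<longlongrightarrow> 0) (at x)" by simp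
  have "((\<lambda>y. ?G y - ?G x) \<longlongrightarrow> 0) (at x)"
    by (rule Lim_null_comparison[OF _ lim]) (use bound in auto)
  then show "(?G \<longlongrightarrow> ?G x) (at x)" by (rule LIM_zero_cancel)
qed

lemma measurable_sym_gauge:
  assumes \<rho>: "sym_gauge n \<rho>" and X: "\<And>i. i < n \<Longrightarrow> X i \<in> borel_measurable M"
  shows "(\<lambda>t. \<rho> (map (\<lambda>i. X i t) [0..<n])) \<in> borel_measurable M"
proof -
  \<comment> \<open>Measurability into the product needs every coordinate, and nothing is known
    about \<open>X i\<close> from \<open>n\<close> on, so those coordinates are set to 0.\<close>
  have "(\<lambda>t i. if i < n then X i t else 0) \<in> borel_measurable M"
  proof (rule measurable_coordinatewise_then_product)
    show "(\<lambda>t. if i < n then X i t else 0) \<in> borel_measurable M" for i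
      using X by (cases "i < n") auto
  qed
  then have "(\<lambda>t. \<rho> (map (\<lambda>i. if i < n then X i t else 0) [0..<n])) \<in> borel_measurable M"
    using borel_measurable_continuous_onI[OF continuous_on_sym_gauge[OF \<rho>]] by (rule measurable_compose)
  then show ?thesis by (simp add: map_upt_if)
qed

section \<open>Ky Fan norms\<close>

text \<open>The sum of the \<open>k\<close> largest absolute values. As a maximum over sets of
  positions it has a termwise triangle inequality, and its permutation invariance is a reindexing;
  order matters only in \<open>kyfan_sorted\<close>.\<close>

definition kyfan :: "nat \<Rightarrow> real list \<Rightarrow> real" where
  "kyfan k x = Max ((\<lambda>S. \<Sum>i\<in>S. \<bar>x ! i\<bar>) ` {S. S \<subseteq> {..<length x} \<and> card S = k})"

context
  fixes k n :: nat
  assumes kn: "k \<le> n"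
begin

lemma kyfan_fin: "finite ((\<lambda>S. \<Sum>i\<in>S. \<bar>x ! i\<bar>) ` {S. S \<subseteq> {..<m} \<and> card S = k})" for x :: "real list"
  by (rule finite_imageI, rule finite_subset[of _ "Pow {..<m}"]) auto

lemma kyfan_ge:
  assumes "length x = n" "S \<subseteq> {..<n}" "card S = k"
  shows "(\<Sum>i\<in>S. \<bar>x ! i\<bar>) \<le> kyfan k x"
  unfolding kyfan_def using assms by (intro Max_ge kyfan_fin) auto

lemma kyfan_le:
  assumes "length x = n" "\<And>S. S \<subseteq> {..<n} \<Longrightarrow> card S = k \<Longrightarrow> (\<Sum>i\<in>S. \<bar>x ! i\<bar>) \<le> c"
  shows "kyfan k x \<le> c"
  unfolding kyfan_def
proof (rule Max.boundedI[OF kyfan_fin])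
  have "{..<k} \<in> {S. S \<subseteq> {..<length x} \<and> card S = k}" using kn assms(1) by auto
  then show "(\<lambda>S. \<Sum>i\<in>S. \<bar>x ! i\<bar>) ` {S. S \<subseteq> {..<length x} \<and> card S = k} \<noteq> {}" by blast
qed (use assms in auto)

lemma kyfan_nonneg: "length x = n \<Longrightarrow> 0 \<le> kyfan k x"
  by (rule order_trans[OF _ kyfan_ge[of x "{..<k}"]]) (use kn in \<open>auto intro: sum_nonneg\<close>)

lemma kyfan_perm_le:
  assumes "length x = n" "mset x = mset y"
  shows "kyfan k y \<le> kyfan k x"
proof -
  have ly: "length y = n" using assms mset_eq_length by metis
  obtain p where p: "p permutes {..<length x}" "permute_list p x = y"
    using mset_eq_permutation[of y x] assms(2) by metis
  show ?thesis
  proof (rule kyfan_le[OF ly])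
    fix S assume S: "S \<subseteq> {..<n}" "card S = k"
    have inj: "inj_on p S" using p(1) permutes_inj inj_on_subset by blast
    have "(\<Sum>i\<in>S. \<bar>y ! i\<bar>) = (\<Sum>i\<in>S. \<bar>x ! p i\<bar>)"
      using S p assms(1) by (intro sum.cong) (auto simp: permute_list_nth)
    also have "\<dots> = (\<Sum>i\<in>p ` S. \<bar>x ! i\<bar>)" using inj by (simp add: sum.reindex)
    also have "\<dots> \<le> kyfan k x"
      using S p assms(1) inj permutes_image[OF p(1)]
      by (intro kyfan_ge) (auto simp: card_image)
    finally show "(\<Sum>i\<in>S. \<bar>y ! i\<bar>) \<le> kyfan k x" .
  qed
qed

lemma kyfan_scale_le:
  assumes "length x = n" shows "kyfan k (map (\<lambda>a. c * a) x) \<le> \<bar>c\<bar> * kyfan k x"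
proof (rule kyfan_le)
  fix S assume S: "S \<subseteq> {..<n}" "card S = k"
  have "(\<Sum>i\<in>S. \<bar>map (\<lambda>a. c * a) x ! i\<bar>) = \<bar>c\<bar> * (\<Sum>i\<in>S. \<bar>x ! i\<bar>)"
    unfolding sum_distrib_left using S assms by (intro sum.cong) (auto simp: abs_mult)
  also have "\<dots> \<le> \<bar>c\<bar> * kyfan k x" using kyfan_ge[OF assms S] by (rule mult_left_mono) simp
  finally show "(\<Sum>i\<in>S. \<bar>map (\<lambda>a. c * a) x ! i\<bar>) \<le> \<bar>c\<bar> * kyfan k x" .
qed (simp add: assms)

lemma sym_gauge_kyfan:
  assumes k: "k \<ge> 1" shows "sym_gauge n (kyfan k)"
  unfolding sym_gauge_def
proof (intro conjI allI impI)
  fix x :: "real list" assume x: "length x = n"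
  show "0 \<le> kyfan k x" by (rule kyfan_nonneg[OF x])
  show "kyfan k x = 0 \<longleftrightarrow> (\<forall>a\<in>set x. a = 0)"
  proof
    assume z: "kyfan k x = 0"
    show "\<forall>a\<in>set x. a = 0"
    proof
      fix a assume "a \<in> set x"
      then obtain i where i: "i < n" "a = x ! i" using x by (metis in_set_conv_nth)
      \<comment> \<open>Definiteness: \<open>k - 1\<close> further positions complete
        \<open>i\<close> to a set of size \<open>k\<close>, which is where \<open>k \<ge> 1\<close>
        enters.\<close>
      have "card ({..<n} - {i}) = n - 1" using i by simp
      then have "k - 1 \<le> card ({..<n} - {i})" using kn by simp
      then obtain T where T: "T \<subseteq> {..<n} - {i}" "card T = k - 1" "finite T"
        by (rule obtain_subset_with_card_n)
      have "(\<Sum>j\<in>insert i T. \<bar>x ! j\<bar>) \<le> kyfan k x"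
        using i T k by (intro kyfan_ge x) (auto simp: card_insert_if)
      moreover have "\<bar>x ! i\<bar> \<le> (\<Sum>j\<in>insert i T. \<bar>x ! j\<bar>)" using T by (intro member_le_sum) auto
      ultimately show "a = 0" using z i by simp
    qed
  next
    assume z: "\<forall>a\<in>set x. a = 0"
    have "kyfan k x \<le> 0"
      by (rule kyfan_le[OF x], rule sum_nonpos) (use z x in auto)
    then show "kyfan k x = 0" using kyfan_nonneg[OF x] by simp
  qed
  show "kyfan k (map abs x) = kyfan k x"
  proof -
    have "(\<lambda>S. \<Sum>i\<in>S. \<bar>map abs x ! i\<bar>) ` {S. S \<subseteq> {..<length x} \<and> card S = k}
        = (\<lambda>S. \<Sum>i\<in>S. \<bar>x ! i\<bar>) ` {S. S \<subseteq> {..<length x} \<and> card S = k}"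
      by (rule image_cong) (auto intro!: sum.cong)
    then show ?thesis by (simp only: kyfan_def length_map)
  qed
next
  fix c :: real and x :: "real list" assume x: "length x = n"
  show "kyfan k (map (\<lambda>a. c * a) x) = \<bar>c\<bar> * kyfan k x"
  proof (rule antisym)
    show "\<bar>c\<bar> * kyfan k x \<le> kyfan k (map (\<lambda>a. c * a) x)"
    proof (cases "c = 0")
      case True
      then show ?thesis using kyfan_nonneg[of "map (\<lambda>a. c * a) x"] x by simp
    next
      case False
      have "kyfan k x \<le> \<bar>1 / c\<bar> * kyfan k (map (\<lambda>a. c * a) x)"
        using kyfan_scale_le[of "map (\<lambda>a. c * a) x" "1 / c"] x False by (simp add: comp_def)
      then show ?thesis using False by (simp add: field_simps)
    qed
  qed (rule kyfan_scale_le[OF x])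
next
  fix x y :: "real list" assume xy: "length x = n \<and> length y = n"
  show "kyfan k (map2 (+) x y) \<le> kyfan k x + kyfan k y"
  proof (rule kyfan_le)
    fix S assume S: "S \<subseteq> {..<n}" "card S = k"
    have "(\<Sum>i\<in>S. \<bar>map2 (+) x y ! i\<bar>) \<le> (\<Sum>i\<in>S. \<bar>x ! i\<bar> + \<bar>y ! i\<bar>)"
      using S xy by (intro sum_mono) auto
    also have "\<dots> \<le> kyfan k x + kyfan k y"
      using S xy by (simp add: sum.distrib add_mono kyfan_ge)
    finally show "(\<Sum>i\<in>S. \<bar>map2 (+) x y ! i\<bar>) \<le> kyfan k x + kyfan k y" .
  qed (use xy in simp)
next
  fix x y :: "real list" assume xy: "length x = n \<and> mset x = mset y"
  then show "kyfan k x = kyfan k y"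
    using kyfan_perm_le[of x y] kyfan_perm_le[of y x] mset_eq_length[of x y] by (intro antisym) auto
qed

text \<open>Exchange argument: \<open>S - {..<k}\<close> and \<open>{..<k} - S\<close> have equal
  size, entries on the former are at most \<open>x k\<close> and entries on the latter at least
  \<open>x k\<close>.\<close>

lemma kyfan_sorted:
  assumes dec: "\<And>i j. i \<le> j \<Longrightarrow> j < n \<Longrightarrow> x j \<le> x i" and nonneg: "\<And>i. i < n \<Longrightarrow> 0 \<le> x i"
  shows "kyfan k (map x [0..<n]) = (\<Sum>i<k. x i)"
proof (rule antisym)
  have "(\<Sum>i<k. x i) = (\<Sum>i<k. \<bar>map x [0..<n] ! i\<bar>)" using kn nonneg by (intro sum.cong) auto
  also have "\<dots> \<le> kyfan k (map x [0..<n])" using kn by (intro kyfan_ge) auto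
  finally show "(\<Sum>i<k. x i) \<le> kyfan k (map x [0..<n])" .
next
  show "kyfan k (map x [0..<n]) \<le> (\<Sum>i<k. x i)"
  proof (rule kyfan_le)
    fix S assume S: "S \<subseteq> {..<n}" "card S = k"
    have fS: "finite S" using S finite_subset by blast
    have "(\<Sum>i\<in>S. \<bar>map x [0..<n] ! i\<bar>) = (\<Sum>i\<in>S. x i)"
      using S nonneg by (intro sum.cong) auto
    also have "\<dots> = (\<Sum>i\<in>S \<inter> {..<k}. x i) + (\<Sum>i\<in>S - {..<k}. x i)"
      using fS by (simp add: sum.Int_Diff[of S _ "{..<k}"])
    also have "(\<Sum>i\<in>S - {..<k}. x i) \<le> (\<Sum>i\<in>{..<k} - S. x i)"
    \<comment> \<open>\<open>x k\<close> is controlled only for \<open>k < n\<close>, which a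
      position of \<open>S\<close> from \<open>k\<close> on guarantees.\<close>
    proof (cases "S - {..<k} = {}")
      case True
      then show ?thesis using kn nonneg by (simp only: True) (auto intro!: sum_nonneg)
    next
      case False
      then have "k < n" using S by auto
      have "card (S - {..<k}) = card ({..<k} - S)"
        using card_Diff_subset_Int[of S "{..<k}"] card_Diff_subset_Int[of "{..<k}" S] fS S
        by (simp add: Int_commute)
      moreover have "(\<Sum>i\<in>S - {..<k}. x i) \<le> of_nat (card (S - {..<k})) * x k"
        using S by (intro sum_bounded_above dec) auto
      moreover have "of_nat (card ({..<k} - S)) * x k \<le> (\<Sum>i\<in>{..<k} - S. x i)"
        using \<open>k < n\<close> by (intro sum_bounded_below dec) auto
      ultimately show ?thesis by simp
    qed
    also have "(\<Sum>i\<in>S \<inter> {..<k}. x i) + (\<Sum>i\<in>{..<k} - S. x i) = (\<Sum>i<k. x i)"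
      by (simp add: sum.Int_Diff[of "{..<k}" _ S] Int_commute)
    finally show "(\<Sum>i\<in>S. \<bar>map x [0..<n] ! i\<bar>) \<le> (\<Sum>i<k. x i)" by simp
  qed simp
qed

end

subsection \<open>Measurability of the eigenvalues\<close>

text \<open>\<open>Sup\<close> on the reals is an upper bound only for sets bounded above.\<close>

lemma bdd_above_op_norm:
  "bdd_above {vnorm Is (tapp Is A x) | x. is_vtensor Is x \<and> vnorm Is x = 1}"
proof -
  have "continuous_on {x. is_vtensor Is x \<and> vnorm Is x = 1} (\<lambda>x. vnorm Is (tapp Is A x))"
    unfolding vnorm_def tapp_def
    by (intro continuous_intros continuous_on_subset[OF continuous_on_product_coordinates]) auto
  then have "bounded ((\<lambda>x. vnorm Is (tapp Is A x)) ` {x. is_vtensor Is x \<and> vnorm Is x = 1})"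
    by (intro compact_imp_bounded compact_continuous_image compact_unit_sphere)
  then show ?thesis by (simp add: bounded_imp_bdd_above setcompr_eq_image)
qed

lemma abs_hevals_le_op_norm:
  assumes H: "hermitian Is H" and x: "x \<in> set (hevals Is H)"
  shows "\<bar>x\<bar> \<le> op_norm Is H"
proof -
  have "set (hevals Is H) = fst (min_decomp Is H) ` {..<herm_rank Is H}"
    by (auto simp: hevals_def)
  with x obtain k where k: "k < herm_rank Is H" "x = fst (min_decomp Is H) k" by auto
  let ?U = "snd (min_decomp Is H) k"
  note d = min_decomp(1)[OF H]
  have on: "orthonormal_fam Is (herm_rank Is H) (snd (min_decomp Is H))"
    using d by (simp add: herm_decomp_def)
  have U: "is_vtensor Is ?U" "vnorm Is ?U = 1"
    using orthonormal_famD(1)[OF on k(1)] orthonormal_fam_vnorm[OF on k(1)] by auto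
  have "vnorm Is (tapp Is H ?U) = \<bar>x\<bar>"
    unfolding herm_decomp_eigen[OF d k(1)] vnorm_scale by (simp add: U k)
  then have "\<bar>x\<bar> \<in> {vnorm Is (tapp Is H x) | x. is_vtensor Is x \<and> vnorm Is x = 1}"
    using U by force
  then have "\<bar>x\<bar> \<le> Sup {vnorm Is (tapp Is H x) | x. is_vtensor Is x \<and> vnorm Is x = 1}"
    using bdd_above_op_norm by (intro cSup_upper)
  then show ?thesis by (simp add: op_norm_def tapp_def)
qed

lemma hevals_decreasing: "i \<le> j \<Longrightarrow> j < herm_rank Is H \<Longrightarrow> hevals Is H ! j \<le> hevals Is H ! i"
  by (rule sorted_rev_nth_mono) (auto simp: hevals_def)

lemma sum_hevals:
  "(\<Sum>k<herm_rank Is H. g (hevals Is H ! k)) = (\<Sum>k<herm_rank Is H. g (fst (min_decomp Is H) k))"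
proof -
  have "(\<Sum>k<herm_rank Is H. g (hevals Is H ! k)) = sum_list (map g (hevals Is H))"
    by (simp add: sum_list_sum_nth atLeast0LessThan)
  also have "\<dots> = sum_mset (image_mset g (mset (hevals Is H)))"
    by (metis mset_map sum_mset_sum_list)
  also have "\<dots> = sum_mset (mset (map (\<lambda>k. g (fst (min_decomp Is H) k)) [0..<herm_rank Is H]))"
    by (simp add: mset_hevals image_mset.compositionality comp_def)
  also have "\<dots> = (\<Sum>k<herm_rank Is H. g (fst (min_decomp Is H) k))"
    unfolding sum_mset_sum_list by (simp add: sum_list_distinct_conv_sum_set atLeast0LessThan)
  finally show ?thesis .
qed

text \<open>The exponent is shifted: \<open>tpow Is H p\<close> is the power \<open>p + 1\<close>.
  Starting at \<open>H\<close> keeps every power diagonal in the eigenvectors of a decomposition of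
  \<open>H\<close>; the identity would add the kernel to the trace.\<close>

primrec tpow :: "nat list \<Rightarrow> (nat list \<Rightarrow> nat list \<Rightarrow> complex) \<Rightarrow> nat \<Rightarrow> (nat list \<Rightarrow> nat list \<Rightarrow> complex)" where
  "tpow Is H 0 = H"
| "tpow Is H (Suc p) = einstein Is H (tpow Is H p)"

lemma tpow_decomp:
  "herm_decomp Is H m lam U \<Longrightarrow> herm_decomp Is (tpow Is H p) m (\<lambda>k. lam k ^ Suc p) U"
  by (induction p) (auto dest: einstein_decomp)

lemma trace_decomp:
  assumes "herm_decomp Is H m lam U"
  shows "(\<Sum>i\<in>tidx Is. H i i) = complex_of_real (\<Sum>k<m. lam k)"
proof -
  have on: "orthonormal_fam Is m U" using assms by (simp add: herm_decomp_def)
  have "(\<Sum>i\<in>tidx Is. H i i) = (\<Sum>i\<in>tidx Is. \<Sum>k<m. lam k * (U k i * cnj (U k i)))"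
    using assms by (simp add: herm_decomp_def outer_def)
  also have "\<dots> = (\<Sum>k<m. lam k * tinner Is (U k) (U k))"
    unfolding tinner_def sum_distrib_left by (rule sum.swap)
  also have "\<dots> = complex_of_real (\<Sum>k<m. lam k)"
    using on by (simp add: orthonormal_famD)
  finally show ?thesis .
qed

lemma measurable_hevals_power_sum:
  assumes herm: "\<And>t. hermitian Is (D t)" and rank: "\<And>t. herm_rank Is (D t) = r"
    and meas: "\<And>i j. (\<lambda>t. D t i j) \<in> borel_measurable M"
  shows "(\<lambda>t. \<Sum>k<r. hevals Is (D t) ! k ^ p) \<in> borel_measurable M"
\<comment> \<open>Exponent 0 gives the constant \<open>r\<close>; a positive one gives a trace of
  \<open>tpow\<close>, a polynomial in the entries of \<open>D t\<close>.\<close>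
proof (cases p)
  case (Suc q)
  have "(\<lambda>t. tpow Is (D t) q i j) \<in> borel_measurable M" for i j
    using meas by (induction q arbitrary: i j) (auto simp: einstein_def)
  then have "(\<lambda>t. Re (\<Sum>i\<in>tidx Is. tpow Is (D t) q i i)) \<in> borel_measurable M"
    by measurable
  moreover have "Re (\<Sum>i\<in>tidx Is. tpow Is (D t) q i i) = (\<Sum>k<r. hevals Is (D t) ! k ^ p)" for t
    using sum_hevals[of "\<lambda>x. x ^ p" Is "D t"]
    by (simp add: trace_decomp[OF tpow_decomp[OF min_decomp(1)[OF herm]]] rank Suc)
  ultimately show ?thesis by simp
qed simp

text \<open>The common bound \<open>B\<close> keeps all eigenvalues in one compact interval, where a
  single sequence of polynomials approximates \<open>g\<close> for every \<open>t\<close>.\<close>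

lemma measurable_hevals_sum:
  fixes g :: "real \<Rightarrow> real"
  assumes herm: "\<And>t. hermitian Is (D t)" and rank: "\<And>t. herm_rank Is (D t) = r"
    and meas: "\<And>i j. (\<lambda>t. D t i j) \<in> borel_measurable M"
    and bound: "\<And>t k. k < r \<Longrightarrow> \<bar>hevals Is (D t) ! k\<bar> \<le> B"
    and g: "continuous_on UNIV g"
  shows "(\<lambda>t. \<Sum>k<r. g (hevals Is (D t) ! k)) \<in> borel_measurable M"
proof -
  have "\<exists>q. real_polynomial_function q \<and> (\<forall>x\<in>{-B..B}. \<bar>g x - q x\<bar> < 1 / real (Suc n))" for n
    using Stone_Weierstrass_real_polynomial_function[of "{-B..B}" g "1 / real (Suc n)"]
      continuous_on_subset[OF g] by (metis compact_Icc of_nat_0_less_iff subset_UNIV zero_less_Suc zero_less_divide_1_iff)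
  then obtain q where q: "\<And>n. real_polynomial_function (q n)"
    "\<And>n x. x \<in> {-B..B} \<Longrightarrow> \<bar>g x - q n x\<bar> < 1 / real (Suc n)" by metis
  show ?thesis
  proof (rule borel_measurable_LIMSEQ_real)
    fix n
    obtain a N where a: "q n = (\<lambda>x. \<Sum>i\<le>N. a i * x ^ i)"
      using q(1)[of n] unfolding real_polynomial_function_iff_sum by blast
    have "(\<Sum>k<r. q n (hevals Is (D t) ! k)) = (\<Sum>i\<le>N. a i * (\<Sum>k<r. hevals Is (D t) ! k ^ i))" for t
      unfolding a sum_distrib_left by (rule sum.swap)
    then show "(\<lambda>t. \<Sum>k<r. q n (hevals Is (D t) ! k)) \<in> borel_measurable M"
      using measurable_hevals_power_sum[OF herm rank meas] by simp
  next
    fix t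
    have "(\<lambda>n. q n (hevals Is (D t) ! k)) \<longlonglongrightarrow> g (hevals Is (D t) ! k)" if k: "k < r" for k
    proof (rule LIM_zero_cancel, rule Lim_null_comparison)
      show "\<forall>\<^sub>F n in sequentially. norm (q n (hevals Is (D t) ! k) - g (hevals Is (D t) ! k)) \<le> 1 / real (Suc n)"
        using q(2)[of "hevals Is (D t) ! k"] bound[OF k, of t]
        by (intro always_eventually allI)
          (metis abs_le_iff abs_minus_commute atLeastAtMost_iff less_imp_le minus_le_iff real_norm_def)
      show "(\<lambda>n. 1 / real (Suc n)) \<longlonglongrightarrow> 0" by (rule lim_1_over_n[THEN LIMSEQ_Suc])
    qed
    then show "(\<lambda>n. \<Sum>k<r. q n (hevals Is (D t) ! k)) \<longlonglongrightarrow> (\<Sum>k<r. g (hevals Is (D t) ! k))"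
      by (intro tendsto_sum) auto
  qed
qed

text \<open>Bridges from continuous functions, which polynomials can approximate, to the indicator
  that counts eigenvalues above \<open>a\<close>.\<close>

lemma tendsto_ramp_indicator: "(\<lambda>n. min 1 (max 0 (real n * (x - a)))) \<longlonglongrightarrow> indicator {a<..} x" for x :: real
proof (cases "a < x")
  case True
  obtain N where N: "1 / (x - a) \<le> real N" using real_arch_simple by blast
  have "min 1 (max 0 (real n * (x - a))) = 1" if "N \<le> n" for n
  proof -
    have "1 / (x - a) \<le> real n" using N that by (meson of_nat_mono order_trans)
    then show ?thesis using True by (simp add: field_simps)
  qed
  then have "\<forall>\<^sub>F n in sequentially. min 1 (max 0 (real n * (x - a))) = 1"
    unfolding eventually_sequentially by blast
  then show ?thesis using True by (simp add: tendsto_eventually)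
next
  case False
  then have "min 1 (max 0 (real n * (x - a))) = 0" for n
    by (simp add: max_def mult_le_0_iff zero_le_mult_iff)
  then show ?thesis using False by simp
qed

text \<open>Entries above \<open>a\<close> fill an initial segment of positions, so a count, which
  is symmetric in the entries, recovers each sorted entry.\<close>

lemma decreasing_gt_iff_card:
  fixes x :: "nat \<Rightarrow> real"
  assumes dec: "\<And>i j. i \<le> j \<Longrightarrow> j < r \<Longrightarrow> x j \<le> x i" and i: "i < r"
  shows "a < x i \<longleftrightarrow> i < card {k. k < r \<and> a < x k}"
proof
  assume "a < x i"
  then have "{..i} \<subseteq> {k. k < r \<and> a < x k}" using dec i by (force intro: less_le_trans)
  then have "card {..i} \<le> card {k. k < r \<and> a < x k}" by (intro card_mono) auto
  then show "i < card {k. k < r \<and> a < x k}" by simp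
next
  assume c: "i < card {k. k < r \<and> a < x k}"
  show "a < x i"
  proof (rule ccontr)
    assume "\<not> a < x i"
    have "{k. k < r \<and> a < x k} \<subseteq> {..<i}"
    proof
      fix k assume k: "k \<in> {k. k < r \<and> a < x k}"
      then have "\<not> i \<le> k" using dec[of i k] \<open>\<not> a < x i\<close> by auto
      then show "k \<in> {..<i}" by simp
    qed
    then have "card {k. k < r \<and> a < x k} \<le> card {..<i}" by (intro card_mono) auto
    then show False using c by simp
  qed
qed

lemma measurable_hevals:
  assumes herm: "\<And>t. hermitian Is (D t)" and rank: "\<And>t. herm_rank Is (D t) = r"
    and meas: "\<And>i j. (\<lambda>t. D t i j) \<in> borel_measurable M"
    and bound: "\<And>t k. k < r \<Longrightarrow> \<bar>hevals Is (D t) ! k\<bar> \<le> B" and i: "i < r"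
  shows "(\<lambda>t. hevals Is (D t) ! i) \<in> borel_measurable M"
  unfolding borel_measurable_iff_greater
proof
  fix a
  let ?N = "\<lambda>t. \<Sum>k<r. indicator {a<..} (hevals Is (D t) ! k) :: real"
  have "?N \<in> borel_measurable M"
  proof (rule borel_measurable_LIMSEQ_real)
    show "(\<lambda>n. \<Sum>k<r. min 1 (max 0 (real n * (hevals Is (D t) ! k - a)))) \<longlonglongrightarrow> ?N t" for t
      by (intro tendsto_sum tendsto_ramp_indicator)
    show "(\<lambda>t. \<Sum>k<r. min 1 (max 0 (real n * (hevals Is (D t) ! k - a)))) \<in> borel_measurable M" for n
      by (rule measurable_hevals_sum[OF herm rank meas bound]) (auto intro!: continuous_intros)
  qed
  then have "{t \<in> space M. real i < ?N t} \<in> sets M" unfolding borel_measurable_iff_greater by blast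
  moreover have "real i < ?N t \<longleftrightarrow> a < hevals Is (D t) ! i" for t
  proof -
    have "?N t = real (card {k. k < r \<and> a < hevals Is (D t) ! k})"
      by (simp add: indicator_def sum.If_cases Int_def)
    then show ?thesis
      using decreasing_gt_iff_card[of r "\<lambda>k. hevals Is (D t) ! k" i a] hevals_decreasing[of _ _ Is "D t"] i
      by (simp add: rank)
  qed
  ultimately show "{t \<in> space M. a < hevals Is (D t) ! i} \<in> sets M" by simp
qed

subsection \<open>Weak majorisation\<close>

text \<open>Summation by parts.\<close>

lemma abel_sum_nonneg:
  fixes c d :: "nat \<Rightarrow> real"
  assumes dec: "\<And>i j. i \<le> j \<Longrightarrow> j < n \<Longrightarrow> c j \<le> c i" and c: "\<And>i. i < n \<Longrightarrow> 0 \<le> c i"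
    and d: "\<And>k. k \<le> n \<Longrightarrow> 0 \<le> (\<Sum>i<k. d i)"
  shows "0 \<le> (\<Sum>i<n. c i * d i)"
proof -
  \<comment> \<open>The last weight is put on the whole partial sum; since that sum is nonnegative,
    the weight may be lowered from \<open>c k\<close> to \<open>c (Suc k)\<close> in the
    induction.\<close>
  have "Suc k \<le> n \<Longrightarrow> c k * (\<Sum>i<Suc k. d i) \<le> (\<Sum>i<Suc k. c i * d i)" for k
  proof (induction k)
    case (Suc k)
    have "c (Suc k) * (\<Sum>i<Suc k. d i) \<le> c k * (\<Sum>i<Suc k. d i)"
      using Suc.prems d[of "Suc k"] by (intro mult_right_mono dec) auto
    with Suc show ?case by (simp add: algebra_simps)
  qed simp
  note lb = this
  show ?thesis
  proof (cases n)
    case (Suc k)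
    then have "0 \<le> c k * (\<Sum>i<Suc k. d i)" using c[of k] d[of n] by simp
    also have "\<dots> \<le> (\<Sum>i<n. c i * d i)" using lb[of k] Suc by simp
    finally show ?thesis .
  qed simp
qed

text \<open>The Tomic-Weyl inequality via subgradients: \<open>f (b i) - f (a i)\<close> is at least
  the slope at \<open>a i\<close> times \<open>b i - a i\<close>. Slopes are nonnegative as
  \<open>f\<close> is non-decreasing and decrease along \<open>i\<close> as \<open>a\<close> does,
  so summation by parts applies.\<close>

lemma convex_mono_weak_maj:
  fixes f :: "real \<Rightarrow> real" and a b :: "nat \<Rightarrow> real"
  assumes f: "mono f" "convex_on UNIV f"
    and dec: "\<And>i j. i \<le> j \<Longrightarrow> j < n \<Longrightarrow> a j \<le> a i"
    and maj: "\<And>k. k \<le> n \<Longrightarrow> (\<Sum>i<k. a i) \<le> (\<Sum>i<k. b i)"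
  shows "(\<Sum>i<n. f (a i)) \<le> (\<Sum>i<n. f (b i))"
proof -
  \<comment> \<open>The right derivative of \<open>f\<close> as an infimum of difference quotients,
    in the shape used by \<open>convex_le_Inf_differential\<close>.\<close>
  define c where "c = (\<lambda>x. Inf ((\<lambda>t. (f x - f t) / (x - t)) ` ({x<..} \<inter> UNIV)))"
  have sub: "f x + c x * (y - x) \<le> f y" for x y
    unfolding c_def using convex_le_Inf_differential[OF f(2), of x y] by simp
  have c0: "0 \<le> c x" for x
    using sub[of x "x - 1"] monoD[OF f(1), of "x - 1" x] by simp
  have cmono: "c x \<le> c y" if "x \<le> y" for x y
  proof (cases "x = y")
    case False
    then have "x < y" using that by simp
    moreover have "(c x - c y) * (y - x) \<le> 0" using sub[of x y] sub[of y x] by (simp add: algebra_simps)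
    ultimately show ?thesis by (simp add: mult_le_0_iff)
  qed simp
  have "0 \<le> (\<Sum>i<n. c (a i) * (b i - a i))"
    using maj by (intro abel_sum_nonneg) (auto intro: cmono dec c0 simp: sum_subtractf)
  also have "\<dots> \<le> (\<Sum>i<n. f (b i) - f (a i))"
    using sub by (intro sum_mono) (simp add: algebra_simps)
  finally show ?thesis by (simp add: sum_subtractf)
qed

lemma convex_on_ramp: "convex_on UNIV (\<lambda>x :: real. max 0 (x + c))"
proof (rule convex_onI)
  fix t x y :: real assume t: "0 < t" "t < 1"
  have "(1 - t) * (x + c) \<le> (1 - t) * max 0 (x + c)" "t * (y + c) \<le> t * max 0 (y + c)"
    "0 \<le> (1 - t) * max 0 (x + c)" "0 \<le> t * max 0 (y + c)"
    using t by (auto intro!: mult_left_mono)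
  moreover have "(1 - t) *\<^sub>R x + t *\<^sub>R y + c = (1 - t) * (x + c) + t * (y + c)"
    by (simp add: algebra_simps)
  ultimately show "max 0 ((1 - t) *\<^sub>R x + t *\<^sub>R y + c) \<le> (1 - t) * max 0 (x + c) + t * max 0 (y + c)"
    by linarith
qed simp

lemma ui_norm_tfun_upt:
  assumes H: "hermitian Is H" and f: "\<And>x. f x \<ge> 0" and \<rho>: "sym_gauge (tsize Is) \<rho>"
  shows "ui_norm Is \<rho> (tfun Is f H)
    = \<rho> (map (\<lambda>k. if k < herm_rank Is H then f (hevals Is H ! k) else 0) [0..<tsize Is])"
proof -
  have "pad (map f (hevals Is H)) (tsize Is)
      = map (\<lambda>k. if k < herm_rank Is H then f (hevals Is H ! k) else 0) [0..<tsize Is]"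
    using herm_rank_le_tsize[OF H] by (intro nth_equalityI) (auto simp: pad_def nth_append)
  then show ?thesis by (simp add: ui_norm_tfun[OF assms])
qed

theorem theorem3p1:
  fixes \<nu> :: "'a::metric_space measure"
    and Is :: "nat list" and r :: nat
    and C :: "nat list \<Rightarrow> nat list \<Rightarrow> complex"
    and D :: "'a \<Rightarrow> nat list \<Rightarrow> nat list \<Rightarrow> complex"
  assumes "sigma_compact_space TYPE('a)"
    and "prob_space \<nu>" and "sets \<nu> = sets borel"
    and "hermitian Is C"
    and "\<forall>\<tau>. hermitian Is (D \<tau>)"
    and "\<forall>i j. continuous_on UNIV (\<lambda>\<tau>. D \<tau> i j)"
    and "bdd_above (range (\<lambda>\<tau>. op_norm Is (D \<tau>)))"
    and "herm_rank Is C = r"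
    and "\<forall>\<tau>. herm_rank Is (D \<tau>) = r"
  shows "weak_maj (hevals Is C)
            (map (\<lambda>i. integral\<^sup>L \<nu> (\<lambda>\<tau>. hevals Is (D \<tau>) ! i)) [0..<r])
         \<longleftrightarrow>
         (\<forall>f \<rho>. mono f \<and> convex_on UNIV f \<and> (\<forall>x. f x \<ge> 0) \<and> sym_gauge (tsize Is) \<rho> \<longrightarrow>
            ui_norm Is \<rho> (tfun Is f C)
              \<le> integral\<^sup>L \<nu> (\<lambda>\<tau>. ui_norm Is \<rho> (tfun Is f (D \<tau>))))"
    (is "?maj \<longleftrightarrow> ?norms")
proof -
  interpret prob_space \<nu> by fact
  have herm: "hermitian Is (D t)" and rank: "herm_rank Is (D t) = r" for t using assms by auto
  define n where "n = tsize Is"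
  have rn: "r \<le> n" using herm_rank_le_tsize[OF assms(4)] assms(8) by (simp add: n_def)
  define a where "a = (\<lambda>k. hevals Is C ! k)"
  define L where "L = (\<lambda>k t. hevals Is (D t) ! k)"
  define b where "b = (\<lambda>k. \<integral>t. L k t \<partial>\<nu>)"
  have adec: "a j \<le> a i" if "i \<le> j" "j < r" for i j
    using hevals_decreasing that assms(8) by (simp add: a_def)
  have Ldec: "L j t \<le> L i t" if "i \<le> j" "j < r" for i j t
    using hevals_decreasing that rank by (simp add: L_def)
  have meas: "(\<lambda>t. D t i j) \<in> borel_measurable \<nu>" for i j
    using borel_measurable_continuous_onI[of "\<lambda>t. D t i j"] assms(3,6)
    by (metis measurable_cong_sets)
  \<comment> \<open>One bound for all spectra; on a probability space it makes the eigenvalues and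
    the quantities built from them integrable.\<close>
  obtain B where B: "\<And>t. op_norm Is (D t) \<le> B" using assms(7) by (auto simp: bdd_above_def)
  have bound: "\<bar>L k t\<bar> \<le> B" if "k < r" for k t
    using abs_hevals_le_op_norm[OF herm, of "L k t" t] B[of t] that
    by (simp add: L_def rank nth_mem)
  have Lmeas: "L k \<in> borel_measurable \<nu>" if "k < r" for k
    unfolding L_def using measurable_hevals[OF herm rank meas _ that, of B] bound by (simp add: L_def)
  have Lint: "integrable \<nu> (L k)" if "k < r" for k
    by (rule integrable_const_bound[of _ B]) (use bound Lmeas that in auto)
  have maj_iff: "?maj \<longleftrightarrow> (\<forall>k\<le>r. (\<Sum>i<k. a i) \<le> (\<Sum>i<k. b i))"
  proof -
    have "?maj \<longleftrightarrow> (\<forall>k\<in>{1..r}. (\<Sum>i<k. a i) \<le> (\<Sum>i<k. b i))"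
      unfolding weak_maj_def by (auto simp: assms(8) a_def b_def L_def)
    also have "\<dots> \<longleftrightarrow> (\<forall>k\<le>r. (\<Sum>i<k. a i) \<le> (\<Sum>i<k. b i))"
      by (metis (no_types, lifting) One_nat_def Suc_leI atLeastAtMost_iff lessThan_0 neq0_conv order_refl sum.empty)
    finally show ?thesis .
  qed
  have normC: "ui_norm Is \<rho> (tfun Is f C) = \<rho> (map (\<lambda>k. if k < r then f (a k) else 0) [0..<n])"
    if "\<And>x. f x \<ge> 0" "sym_gauge n \<rho>" for f \<rho>
    using ui_norm_tfun_upt[OF assms(4) that(1) that(2)[unfolded n_def]] unfolding a_def n_def assms(8) .
  have normD: "ui_norm Is \<rho> (tfun Is f (D t)) = \<rho> (map (\<lambda>k. if k < r then f (L k t) else 0) [0..<n])"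
    if "\<And>x. f x \<ge> 0" "sym_gauge n \<rho>" for f \<rho> t
    using ui_norm_tfun_upt[OF herm that(1) that(2)[unfolded n_def]] unfolding L_def n_def rank .
  show ?thesis
  proof
    assume ?maj
    then have maj: "\<And>k. k \<le> r \<Longrightarrow> (\<Sum>i<k. a i) \<le> (\<Sum>i<k. b i)" by (simp add: maj_iff)
    show ?norms
    proof (intro allI impI)
      fix f :: "real \<Rightarrow> real" and \<rho> :: "real list \<Rightarrow> real"
      assume "mono f \<and> convex_on UNIV f \<and> (\<forall>x. f x \<ge> 0) \<and> sym_gauge (tsize Is) \<rho>"
      then have f: "mono f" "convex_on UNIV f" "\<And>x. f x \<ge> 0" and \<rho>: "sym_gauge n \<rho>"
        by (auto simp: n_def)
      define X where "X = (\<lambda>k t. if k < r then f (L k t) else 0)"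
      have Xmeas: "X k \<in> borel_measurable \<nu>" for k
        using measurable_compose[OF Lmeas borel_measurable_mono[OF f(1)]]
        by (cases "k < r") (auto simp: X_def)
      have Xbound: "\<bar>X k t\<bar> \<le> f B" for k t
        using bound[of k t] f(3) monoD[OF f(1), of "L k t" B] by (auto simp: X_def abs_le_iff)
      have Xint: "integrable \<nu> (X k)" for k
        by (rule integrable_const_bound[of _ "f B"]) (use Xbound Xmeas in auto)
      have jen: "f (b k) \<le> (\<integral>t. X k t \<partial>\<nu>)" if "k < r" for k
        using jensens_inequality[where X = "L k" and I = UNIV and q = f] Lint[OF that] Xint[of k] f(2) that
        by (simp add: X_def b_def)
      define K where "K = (\<Sum>i<n. f B * \<rho> (map (\<lambda>j. if j = i then 1 else 0) [0..<n]))"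
      have "norm (\<rho> (map (\<lambda>k. X k t) [0..<n])) \<le> K" for t
        using sym_gauge_nonneg[OF \<rho>, of "\<lambda>k. X k t"]
          order_trans[OF sym_gauge_le_sum[OF \<rho>, of "\<lambda>k. X k t"], of K]
        unfolding K_def by (auto intro!: sum_mono mult_right_mono Xbound sym_gauge_nonneg[OF \<rho>])
      then have \<rho>int: "integrable \<nu> (\<lambda>t. \<rho> (map (\<lambda>k. X k t) [0..<n]))"
        by (intro integrable_const_bound[of _ K] measurable_sym_gauge[OF \<rho>] Xmeas) auto
      have "\<rho> (map (\<lambda>k. if k < r then f (a k) else 0) [0..<n]) \<le> \<rho> (map (\<lambda>k. \<integral>t. X k t \<partial>\<nu>) [0..<n])"
      proof (rule sym_gauge_weak_maj_mono[OF \<rho>])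
        fix k assume k: "k \<le> n"
        \<comment> \<open>From \<open>r\<close> on both padded vectors are 0, so their partial sums
          stop growing at \<open>min k r\<close>; this is where the common rank is used.\<close>
        have m: "min k r \<le> r" by simp
        have "(\<Sum>i<k. if i < r then f (a i) else 0) = (\<Sum>i<min k r. f (a i))"
          by (rule sum.mono_neutral_cong_right) auto
        also have "\<dots> \<le> (\<Sum>i<min k r. f (b i))"
          by (rule convex_mono_weak_maj[OF f(1,2)]) (auto intro: adec maj)
        also have "\<dots> \<le> (\<Sum>i<min k r. \<integral>t. X i t \<partial>\<nu>)"
          by (rule sum_mono) (auto intro: jen)
        also have "\<dots> = (\<Sum>i<k. \<integral>t. X i t \<partial>\<nu>)"
          by (rule sum.mono_neutral_left) (auto simp: X_def min_le_iff_disj)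
        finally show "(\<Sum>i<k. if i < r then f (a i) else 0) \<le> (\<Sum>i<k. \<integral>t. X i t \<partial>\<nu>)" .
      qed (use f monoD[OF f(1) adec] in auto)
      also have "\<dots> \<le> (\<integral>t. \<rho> (map (\<lambda>k. X k t) [0..<n]) \<partial>\<nu>)"
        by (rule sym_gauge_jensen[OF \<rho> Xint \<rho>int])
      finally show "ui_norm Is \<rho> (tfun Is f C) \<le> (\<integral>t. ui_norm Is \<rho> (tfun Is f (D t)) \<partial>\<nu>)"
        by (simp add: normC[OF f(3) \<rho>] normD[OF f(3) \<rho>] X_def)
    qed
  next
    assume norms: ?norms
    \<comment> \<open>Dominates the absolute value of every eigenvalue of \<open>C\<close> and of
      every \<open>D t\<close>, so \<open>f\<close> acts on all these spectra as the shift by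
      \<open>c\<close>.\<close>
    define c where "c = max B (op_norm Is C)"
    have ac: "- c \<le> a k" if "k < r" for k
    proof -
      have "\<bar>a k\<bar> \<le> op_norm Is C"
        unfolding a_def using that by (intro abs_hevals_le_op_norm[OF assms(4)] nth_mem) (simp add: assms(8))
      then show ?thesis by (simp add: c_def)
    qed
    have Lc: "- c \<le> L k t" if "k < r" for k t
      using bound[OF that, of t] by (auto simp: c_def abs_le_iff)
    define f where "f = (\<lambda>x. max 0 (x + c))"
    have f: "mono f" "convex_on UNIV f" "\<And>x. f x \<ge> 0"
      by (auto simp: f_def mono_def convex_on_ramp)
    \<comment> \<open>As \<open>f\<close> is nonnegative, the zero padding stays at the end of the
      decreasing order, and the Ky Fan norm picks the first \<open>k\<close> shifted eigenvalues.
      The same computation serves \<open>C\<close> and every \<open>D t\<close>.\<close>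
    have kf: "kyfan k (map (\<lambda>i. if i < r then f (x i) else 0) [0..<n]) = (\<Sum>i<k. x i) + k * c"
      if k: "k \<le> r" and dec: "\<And>i j. i \<le> j \<Longrightarrow> j < r \<Longrightarrow> x j \<le> x i" and x: "\<And>i. i < r \<Longrightarrow> - c \<le> x i"
      for k x
    proof -
      have "kyfan k (map (\<lambda>i. if i < r then f (x i) else 0) [0..<n]) = (\<Sum>i<k. if i < r then f (x i) else 0)"
        using k rn by (intro kyfan_sorted) (use monoD[OF f(1) dec] f(3) in auto)
      also have "\<dots> = (\<Sum>i<k. x i + c)"
      proof (rule sum.cong)
        fix i assume "i \<in> {..<k}"
        then show "(if i < r then f (x i) else 0) = x i + c" using k x[of i] by (simp add: f_def)
      qed simp
      finally show ?thesis by (simp add: sum.distrib)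
    qed
    have "(\<Sum>i<k. a i) \<le> (\<Sum>i<k. b i)" if k: "k \<le> r" "1 \<le> k" for k
    proof -
      have Lint': "integrable \<nu> (L i)" if "i < k" for i using Lint k that by simp
      have \<rho>: "sym_gauge n (kyfan k)" using k rn by (intro sym_gauge_kyfan) auto
      have "(\<Sum>i<k. a i) + k * c = ui_norm Is (kyfan k) (tfun Is f C)"
        unfolding normC[OF f(3) \<rho>] by (rule kf[OF k(1) adec ac, symmetric])
      also have "\<dots> \<le> (\<integral>t. ui_norm Is (kyfan k) (tfun Is f (D t)) \<partial>\<nu>)"
        using norms f \<rho> by (simp add: n_def)
      also have "\<dots> = (\<integral>t. (\<Sum>i<k. L i t) + k * c \<partial>\<nu>)"
        unfolding normD[OF f(3) \<rho>] by (subst kf[OF k(1) Ldec Lc]) auto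
      \<comment> \<open>Total mass 1 leaves the constant at \<open>k * c\<close>, which then
        cancels.\<close>
      also have "\<dots> = (\<Sum>i<k. b i) + k * c"
        using Lint' by (subst Bochner_Integration.integral_add)
          (auto simp: b_def prob_space intro!: Bochner_Integration.integral_sum)
      finally show ?thesis by simp
    qed
    \<comment> \<open>Order 0 gives no gauge function, but there both sums are empty.\<close>
    then show ?maj unfolding maj_iff
      by (metis (no_types, lifting) One_nat_def Suc_leI lessThan_0 neq0_conv order_refl sum.empty)
  qed
qed

end
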